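(* Let $H_\omega$, $\omega\in\Omega$, be the selfadjoint Sturm–Liouville operators with $\delta'$-point interactions described in the context. Let $E\in\mathbb{R}$ be fixed and let $B$ be any measurable subset of $A(E):=\{\omega\in\Omega: E\in\sigma_p(H_\omega)\}$. Then one of the following holds: (i) $\mathbb{P}(B)=0$; (ii) $A(E)=\Omega$.
   Context: Probability space: let $I\subseteq\mathbb{Z}$ and let $\{p_n\}_{n\in I}$ be probability measures on $\mathbb{R}$ that are continuous, i.e. $p_n(\{r\})=0$ for all $r\in\mathbb{R}$. $\Omega$ denotes the completion of the product probability space $(\mathbb{R}^I,\mathcal{F},\mathbb{P})$, where $\mathbb{P}=\times_{n\in I}p_n$ and $\mathcal{F}$ is the product $\sigma$-algebra generated by cylinder sets; elements are sequences $\omega=\{\omega(n)\}_{n\in I}$, and "measurable" refers to the completed $\sigma$-algebra. Operators ($\delta'$-interactions): let $-\infty\le a<b\le\infty$, let $V\in L^1_{loc}(a,b)$ be real valued, and let $M=\{x_n\}_{n\in I}\subset(a,b)$ be a discrete set of distinct points which accumulate at most at $a$ or $b$. Let $\tau f=-f''+Vf$. For $\omega\in\Omega$, the formal expression $\tau_\omega=-\frac{d^2}{dx^2}+V(x)+\sum_{n\in I}\omega(n)\delta'(x-x_n)$ has maximal operator $T_\omega f=\tau f$ with domain $D(T_\omega)$ consisting of all $f\in L^2(a,b)$ such that $f,f'$ are (locally) absolutely continuous in $(a,b)\setminus M$, $-f''+Vf\in L^2(a,b)$, and $f'(x_n+)=f'(x_n-)$, $f(x_n+)-f(x_n-)=\omega(n)f'(x_n)$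 for all $n\in I$. A solution of $(\tau_\omega-z)f=0$ ($z\in\mathbb{C}$) is a function $f$ with $f,f'$ (locally) absolutely continuous in $(a,b)\setminus M$, $-f''+Vf-zf=0$, satisfying the same conditions at all $x_n$. $\tau_\omega$ is regular at $a$ if $a$ is finite, $V\in L^1_{loc}[a,b)$ and $a$ is not an accumulation point of $M$; it is in the limit point case (lpc) at $a$ if for every $z\in\mathbb{C}$ there is at least one solution of $(\tau_\omega-z)f=0$ which is not square integrable near $a$; similarly at $b$. Standing assumption: at each of the endpoints $a$, $b$, $\tau_\omega$ is either regular or in the limit point case (for the operators $H_\omega$, $\omega\in\Omega$). For fixed $\theta,\gamma\in[0,\pi)$, $H_\omega$ is the selfadjoint restriction of $T_\omega$ to those $f\in D(T_\omega)$ satisfying $f(a)\cos\theta+f'(a)\sin\theta=0$ if $\tau_\omega$ is regular at $a$, and $f(b)\cos\gamma+f'(b)\sin\gamma=0$ if $\tau_\omega$ is regular at $b$ (no condition at an lpc endpoint). $\sigma_p(L)$ denotes the set of eigenvalues of $L$. *)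

theory Defs
  imports "HOL-Analysis.Analysis" "HOL-Probability.Probability"
begin

text \<open>
  Functions \<open>f :: real \<Rightarrow> complex\<close> stand for elements of \<open>L\<^sup>2(a,b)\<close>; equality there is equality almost
  everywhere on \<open>(a,b)\<close>. The interval \<open>(a,b)\<close> with extended real endpoints is \<^term>\<open>einterval a b\<close>,
  and the interaction centres are \<open>M = x ` I\<close>.
\<close>

definition abs_cont_on :: "real set \<Rightarrow> (real \<Rightarrow> 'a::real_normed_vector) \<Rightarrow> bool" where
  "abs_cont_on S f \<longleftrightarrow>
     (\<forall>\<epsilon>>0. \<exists>\<delta>>0. \<forall>D T. D division_of T \<and> T \<subseteq> S \<and> (\<Sum>K\<in>D. Sup K - Inf K) < \<delta> \<longrightarrow>
        (\<Sum>K\<in>D. norm (f (Sup K) - f (Inf K))) < \<epsilon>)"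

definition locally_abs_cont_on :: "real set \<Rightarrow> (real \<Rightarrow> 'a::real_normed_vector) \<Rightarrow> bool" where
  "locally_abs_cont_on S f \<longleftrightarrow> (\<forall>c d. {c..d} \<subseteq> S \<longrightarrow> abs_cont_on {c..d} f)"

definition locally_integrable_on :: "real set \<Rightarrow> (real \<Rightarrow> real) \<Rightarrow> bool" where
  "locally_integrable_on S V \<longleftrightarrow> (\<forall>c d. {c..d} \<subseteq> S \<longrightarrow> V absolutely_integrable_on {c..d})"

definition square_integrable_on :: "real set \<Rightarrow> (real \<Rightarrow> complex) \<Rightarrow> bool" where
  "square_integrable_on S f \<longleftrightarrow>
     f \<in> borel_measurable (lebesgue_on S) \<and> integrable (lebesgue_on S) (\<lambda>t. (cmod (f t))\<^sup>2)"

definition D1 :: "(real \<Rightarrow> complex) \<Rightarrow> real \<Rightarrow> complex" where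
  "D1 f t = vector_derivative f (at t)"

definition AC2_on :: "real set \<Rightarrow> (real \<Rightarrow> complex) \<Rightarrow> bool" where
  "AC2_on S f \<longleftrightarrow>
     (\<forall>t\<in>S. f differentiable at t) \<and> locally_abs_cont_on S f \<and> locally_abs_cont_on S (D1 f)"

text \<open>
  \<open>g = \<tau> f = - f'' + V f\<close> almost everywhere on \<open>S\<close>. A relation rather than a function, because
  \<open>f''\<close> exists only almost everywhere.
\<close>
definition tau_eq :: "real set \<Rightarrow> (real \<Rightarrow> real) \<Rightarrow> (real \<Rightarrow> complex) \<Rightarrow> (real \<Rightarrow> complex) \<Rightarrow> bool" where
  "tau_eq S V f g \<longleftrightarrow>
     (AE t in lebesgue_on S. \<exists>f2. (D1 f has_vector_derivative f2) (at t) \<and>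
        g t = - f2 + complex_of_real (V t) * f t)"

text \<open>
  \<open>f'(y+) = f'(y-)\<close> and \<open>f(y+) - f(y-) = \<alpha> f'(y)\<close>; the values of \<open>f\<close> and of \<^term>\<open>D1 f\<close> at \<open>y\<close>
  itself play no role, and \<open>f'(y)\<close> means the common value of \<open>f'(y+)\<close> and \<open>f'(y-)\<close>.
\<close>
definition delta'_condition :: "real \<Rightarrow> real \<Rightarrow> (real \<Rightarrow> complex) \<Rightarrow> bool" where
  "delta'_condition \<alpha> y f \<longleftrightarrow>
     (\<exists>u v d. (f \<longlongrightarrow> u) (at_left y) \<and> (f \<longlongrightarrow> v) (at_right y) \<and>
        (D1 f \<longlongrightarrow> d) (at_left y) \<and> (D1 f \<longlongrightarrow> d) (at_right y) \<and>
        v - u = complex_of_real \<alpha> * d)"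

definition solution ::
  "ereal \<Rightarrow> ereal \<Rightarrow> (real \<Rightarrow> real) \<Rightarrow> int set \<Rightarrow> (int \<Rightarrow> real) \<Rightarrow> (int \<Rightarrow> real) \<Rightarrow> complex \<Rightarrow>
     (real \<Rightarrow> complex) \<Rightarrow> bool" where
  "solution a b V I x \<omega> z f \<longleftrightarrow>
     AC2_on (einterval a b - x ` I) f \<and>
     tau_eq (einterval a b) V f (\<lambda>t. z * f t) \<and>
     (\<forall>n\<in>I. delta'_condition (\<omega> n) (x n) f)"

definition regular_left :: "ereal \<Rightarrow> ereal \<Rightarrow> (real \<Rightarrow> real) \<Rightarrow> int set \<Rightarrow> (int \<Rightarrow> real) \<Rightarrow> bool" where
  "regular_left a b V I x \<longleftrightarrow>
     \<bar>a\<bar> \<noteq> \<infinity> \<and> locally_integrable_on (insert (real_of_ereal a) (einterval a b)) V \<and>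
     \<not> real_of_ereal a islimpt x ` I"

definition regular_right :: "ereal \<Rightarrow> ereal \<Rightarrow> (real \<Rightarrow> real) \<Rightarrow> int set \<Rightarrow> (int \<Rightarrow> real) \<Rightarrow> bool" where
  "regular_right a b V I x \<longleftrightarrow>
     \<bar>b\<bar> \<noteq> \<infinity> \<and> locally_integrable_on (insert (real_of_ereal b) (einterval a b)) V \<and>
     \<not> real_of_ereal b islimpt x ` I"

definition lpc_left ::
  "ereal \<Rightarrow> ereal \<Rightarrow> (real \<Rightarrow> real) \<Rightarrow> int set \<Rightarrow> (int \<Rightarrow> real) \<Rightarrow> (int \<Rightarrow> real) \<Rightarrow> bool" where
  "lpc_left a b V I x \<omega> \<longleftrightarrow>
     (\<forall>z. \<exists>f. solution a b V I x \<omega> z f \<and>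
        \<not> (\<exists>c\<in>einterval a b. square_integrable_on (einterval a (ereal c)) f))"

definition lpc_right ::
  "ereal \<Rightarrow> ereal \<Rightarrow> (real \<Rightarrow> real) \<Rightarrow> int set \<Rightarrow> (int \<Rightarrow> real) \<Rightarrow> (int \<Rightarrow> real) \<Rightarrow> bool" where
  "lpc_right a b V I x \<omega> \<longleftrightarrow>
     (\<forall>z. \<exists>f. solution a b V I x \<omega> z f \<and>
        \<not> (\<exists>c\<in>einterval a b. square_integrable_on (einterval (ereal c) b) f))"

text \<open>
  The operators are given by their graphs. The first component of a pair is the locally absolutely
  continuous representative; the second one is only determined almost everywhere.
\<close>
definition T_max ::
  "ereal \<Rightarrow> ereal \<Rightarrow> (real \<Rightarrow> real) \<Rightarrow> int set \<Rightarrow> (int \<Rightarrow> real) \<Rightarrow> (int \<Rightarrow> real) \<Rightarrow>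
     ((real \<Rightarrow> complex) \<times> (real \<Rightarrow> complex)) set" where
  "T_max a b V I x \<omega> =
     {(f, g). square_integrable_on (einterval a b) f \<and>
        AC2_on (einterval a b - x ` I) f \<and>
        tau_eq (einterval a b) V f g \<and> square_integrable_on (einterval a b) g \<and>
        (\<forall>n\<in>I. delta'_condition (\<omega> n) (x n) f)}"

text \<open>
  \<open>f(e) cos \<phi> + f'(e) sin \<phi> = 0\<close> at an endpoint \<open>e\<close>, approached along the filter \<open>F\<close>; the values of
  \<open>f\<close> and \<open>f'\<close> at \<open>e\<close> are their boundary limits.
\<close>
definition boundary_condition :: "real filter \<Rightarrow> real \<Rightarrow> (real \<Rightarrow> complex) \<Rightarrow> bool" where
  "boundary_condition F \<phi> f \<longleftrightarrow>
     (\<exists>u d. (f \<longlongrightarrow> u) F \<and> (D1 f \<longlongrightarrow> d) F \<and>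
        u * complex_of_real (cos \<phi>) + d * complex_of_real (sin \<phi>) = 0)"

definition H_op ::
  "ereal \<Rightarrow> ereal \<Rightarrow> (real \<Rightarrow> real) \<Rightarrow> int set \<Rightarrow> (int \<Rightarrow> real) \<Rightarrow> real \<Rightarrow> real \<Rightarrow> (int \<Rightarrow> real) \<Rightarrow>
     ((real \<Rightarrow> complex) \<times> (real \<Rightarrow> complex)) set" where
  "H_op a b V I x \<theta> \<gamma> \<omega> =
     {(f, g) \<in> T_max a b V I x \<omega>.
        (regular_left a b V I x \<longrightarrow> boundary_condition (at_right (real_of_ereal a)) \<theta> f) \<and>
        (regular_right a b V I x \<longrightarrow> boundary_condition (at_left (real_of_ereal b)) \<gamma> f)}"

definition point_spectrum ::
  "real set \<Rightarrow> ((real \<Rightarrow> complex) \<times> (real \<Rightarrow> complex)) set \<Rightarrow> complex set" where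
  "point_spectrum S L =
     {z. \<exists>f. (f, \<lambda>t. z * f t) \<in> L \<and> \<not> (AE t in lebesgue_on S. f t = 0)}"

definition eigenvalue_event ::
  "ereal \<Rightarrow> ereal \<Rightarrow> (real \<Rightarrow> real) \<Rightarrow> int set \<Rightarrow> (int \<Rightarrow> real) \<Rightarrow> real \<Rightarrow> real \<Rightarrow>
     (int \<Rightarrow> real) measure \<Rightarrow> real \<Rightarrow> (int \<Rightarrow> real) set" where
  "eigenvalue_event a b V I x \<theta> \<gamma> \<Omega> E =
     {\<omega> \<in> space \<Omega>. complex_of_real E \<in> point_spectrum (einterval a b) (H_op a b V I x \<theta> \<gamma> \<omega>)}"

end

theory Submission
  imports Defs
begin

text \<open>
  Let \<open>B\<close> have positive measure. Since all the \<open>p n\<close> are continuous, Fubini's theorem shows that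
  for almost every point \<open>w\<close> of \<open>B\<close> and every \<open>n\<close>, the line through \<open>w\<close> in direction \<open>n\<close> meets
  \<open>B\<close> in a set of positive \<open>p n\<close>-measure, hence in a point other than \<open>w\<close>. The index set is
  countable, so a single \<open>w \<in> B\<close> serves all \<open>n\<close> at once
  (\<open>exists_point_with_movable_coordinates\<close>).

  Let \<open>f\<close> be an eigenfunction for this \<open>w\<close>, and let \<open>g\<close> be one for the same energy after changing
  \<open>w n\<close> to some \<open>r \<noteq> w n\<close>. The Wronskian \<open>W = f g' - f' g\<close> is constant between centres, and it does
  not jump at a centre where \<open>f\<close> and \<open>g\<close> have the same coupling; so it is constant to the left of
  \<open>x n\<close> and constant to the right of it. At a regular endpoint \<open>W\<close> vanishes because \<open>f\<close> and \<open>g\<close> satisfy the same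
  boundary condition; at a limit point endpoint a non-zero \<open>W\<close> would make every solution a
  linear combination of \<open>f\<close> and \<open>g\<close>, hence square integrable. So \<open>W = 0\<close> on both sides of \<open>x n\<close>,
  while the jump conditions say that \<open>W\<close> jumps there by \<open>(w n - r) f'(x n) g'(x n)\<close>. If \<open>f'(x n) \<noteq> 0\<close>,
  then \<open>g'(x n) = 0\<close>, and \<open>W = 0\<close> forces \<open>g(x n-) = 0\<close> as well, so that \<open>g\<close> is identically zero by
  uniqueness for the initial value problem (\<open>solution_zero_of_zero_data\<close>). Hence \<open>f'(x n) = 0\<close>
  (\<open>eigenfunction_derivative_zero_at_moved_centre\<close>).

  An \<open>f\<close> whose derivative vanishes at every centre is continuous there and satisfies the interaction
  condition for every value of the coupling. It is therefore an eigenfunction for all points of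
  the sample space.

  The differential equation holds only almost everywhere, so the two analytic facts used above,
  constancy of the Wronskian and uniqueness, rest on the fundamental theorem of calculus for
  absolutely continuous functions (\<open>abs_cont_on_fundamental_theorem\<close>).
\<close>

section \<open>Absolutely continuous functions\<close>

lemma abs_cont_onD:
  assumes "abs_cont_on S f" "e > 0"
  obtains \<delta> where "\<delta> > 0" "\<And>D T. D division_of T \<Longrightarrow> T \<subseteq> S \<Longrightarrow> (\<Sum>K\<in>D. Sup K - Inf K) < \<delta> \<Longrightarrow>
        (\<Sum>K\<in>D. norm (f (Sup K) - f (Inf K))) < e"
  using assms unfolding abs_cont_on_def by metis

lemma negligible_open_cover:
  fixes N :: "'a::euclidean_space set"
  assumes "negligible N" "\<delta> > 0"
  obtains G where "open G" "N \<subseteq> G" "G \<in> lmeasurable" "measure lebesgue G < \<delta>"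
proof -
  have N: "N \<in> null_sets lebesgue" using assms(1) negligible_iff_null_sets by blast
  then obtain G where G: "open G" "N \<subseteq> G" "(G - N) \<in> lmeasurable" "emeasure lebesgue (G - N) < ennreal \<delta>"
    using sets_lebesgue_outer_open[of N \<delta>] assms(2) by blast
  have eq: "emeasure lebesgue G = emeasure lebesgue (G - N)"
    using emeasure_Diff_null_set[OF N, of G] G(1) by simp
  with G have "emeasure lebesgue G < ennreal \<delta>" by simp
  then have fin: "emeasure lebesgue G < \<top>" by (rule less_trans) (rule ennreal_less_top)
  with G(1) have "G \<in> lmeasurable" by (simp add: fmeasurable_def)
  moreover have "measure lebesgue G < \<delta>"
    using \<open>emeasure lebesgue G < ennreal \<delta>\<close> fin assms(2)
    by (simp add: emeasure_eq_ennreal_measure ennreal_less_iff)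
  ultimately show ?thesis using G(1,2) that by blast
qed

text \<open>
  Links the sum of lengths in the definition of absolute continuity to Lebesgue measure: the
  intervals of a partial division overlap only in null sets.
\<close>
lemma partial_division_total_length_le:
  fixes p :: "(real \<times> real set) set"
  assumes p: "p tagged_partial_division_of S" and sub: "\<And>t K. (t, K) \<in> p \<Longrightarrow> K \<subseteq> G"
    and G: "G \<in> lmeasurable"
  shows "(\<Sum>K\<in>snd ` p. Sup K - Inf K) \<le> measure lebesgue G"
proof -
  have div: "(snd ` p) division_of \<Union>(snd ` p)" by (rule partial_division_of_tagged_division[OF p])
  have len: "Sup K - Inf K = measure lebesgue K" if "K \<in> snd ` p" for K
  proof -
    have "K \<noteq> {}" "\<exists>u v. K = cbox u v" using division_ofD(3,4)[OF div] that by auto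
    then show ?thesis by force
  qed
  have "(\<Sum>K\<in>snd ` p. Sup K - Inf K) = (\<Sum>K\<in>snd ` p. measure lebesgue K)" using len by simp
  also have "\<dots> = measure lebesgue (\<Union>(snd ` p))" using content_division[OF div] by simp
  also have "\<dots> \<le> measure lebesgue G"
  proof (rule measure_mono_fmeasurable)
    show "\<Union> (snd ` p) \<subseteq> G" using sub by force
  qed (use G lmeasurable_division[OF div] in \<open>auto simp: fmeasurableD\<close>)
  finally show ?thesis .
qed

text \<open>
  The gauge is chosen differently on and off the exceptional set \<open>N\<close>. Off \<open>N\<close> differentiability
  gives the usual straddle estimate. At tags in \<open>N\<close> the gauge is an open set of measure less than
  \<open>\<delta>\<close>, so the intervals with such tags have total length less than \<open>\<delta>\<close>, and absolute continuity
  bounds the sum of the increments of \<open>f\<close> over them.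
\<close>
theorem abs_cont_on_fundamental_theorem:
  fixes f :: "real \<Rightarrow> 'a::banach"
  assumes ab: "a \<le> b" and ac: "abs_cont_on {a..b} f" and N: "negligible N"
    and vecd: "\<And>t. t \<in> {a..b} - N \<Longrightarrow> (f has_vector_derivative g t) (at t within {a..b})"
  shows "(g has_integral (f b - f a)) {a..b}"
proof -
  \<comment> \<open>Setting the integrand to \<open>0\<close> on \<open>N\<close> removes the Riemann terms with tags in \<open>N\<close>.\<close>
  define h where "h t = (if t \<in> N then 0 else g t)" for t
  have "(h has_integral (f b - f a)) (cbox a b)"
    unfolding has_integral
  proof (intro allI impI)
    fix e :: real assume "e > 0"
    \<comment> \<open>The \<open>1\<close> in the denominator covers the degenerate case \<open>a = b\<close>.\<close>
    define \<eta> where "\<eta> = e / (2 * (b - a + 1))"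
    have \<eta>: "\<eta> > 0" "\<eta> * (b - a) < e / 2"
      using \<open>e > 0\<close> ab by (auto simp: \<eta>_def field_simps)
    have "\<forall>t. \<exists>d>0. t \<in> {a..b} - N \<longrightarrow>
        (\<forall>y\<in>{a..b}. norm (y-t) < d \<longrightarrow> norm (f y - f t - (y-t) *\<^sub>R g t) \<le> \<eta> * norm (y-t))"
      using vecd[unfolded has_vector_derivative_def has_derivative_within_alt] \<eta>(1)
      by (meson zero_less_one)
    then obtain d where d: "\<And>t. 0 < d t"
      "\<And>t y. \<lbrakk>t \<in> {a..b} - N; y \<in> {a..b}; norm (y-t) < d t\<rbrakk>
                   \<Longrightarrow> norm (f y - f t - (y-t) *\<^sub>R g t) \<le> \<eta> * norm (y-t)"
      by metis
    obtain \<delta> where \<delta>: "\<delta> > 0" "\<And>D T. D division_of T \<Longrightarrow> T \<subseteq> {a..b} \<Longrightarrow>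
        (\<Sum>K\<in>D. Sup K - Inf K) < \<delta> \<Longrightarrow> (\<Sum>K\<in>D. norm (f (Sup K) - f (Inf K))) < e / 2"
      using abs_cont_onD[OF ac, of "e/2"] \<open>e > 0\<close> by auto
    obtain G where G: "open G" "N \<subseteq> G" "G \<in> lmeasurable" "measure lebesgue G < \<delta>"
      using negligible_open_cover[OF N \<delta>(1)] by blast
    define \<gamma> where "\<gamma> t = (if t \<in> N then G else ball t (d t))" for t
    show "\<exists>\<gamma>. gauge \<gamma> \<and> (\<forall>p. p tagged_division_of cbox a b \<and> \<gamma> fine p \<longrightarrow>
        norm ((\<Sum>(t, K)\<in>p. measure lborel K *\<^sub>R h t) - (f b - f a)) < e)"
    proof (intro exI conjI allI impI)
      show "gauge \<gamma>" unfolding gauge_def \<gamma>_def using G d(1) by auto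
      fix p assume "p tagged_division_of cbox a b \<and> \<gamma> fine p"
      then have p: "p tagged_division_of {a..b}" and fine: "\<gamma> fine p" by auto
      have fin: "finite p" using p by blast
      let ?\<Delta> = "\<lambda>K. f (Sup K) - f (Inf K)"
      have tele: "f b - f a = (\<Sum>(t,K)\<in>p. ?\<Delta> K)" "b - a = (\<Sum>(t,K)\<in>p. Sup K - Inf K)"
        using additive_tagged_division_1[OF ab p, of f] additive_tagged_division_1[OF ab p, of "\<lambda>x. x"]
        by auto
      define q where "q = {tK \<in> p. fst tK \<in> N}"
      have "q \<subseteq> p" by (auto simp: q_def)
      have on_N: "(\<Sum>(t,K)\<in>q. norm (?\<Delta> K)) < e / 2"
      proof -
        have q: "q tagged_partial_division_of {a..b}"
          using p \<open>q \<subseteq> p\<close> tagged_partial_division_subset unfolding tagged_division_of_def by blast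
        have sub: "K \<subseteq> G" if "(t, K) \<in> q" for t K
          using fine that by (fastforce simp: q_def \<gamma>_def fine_def)
        \<comment> \<open>\<open>Sup {}\<close> is unspecified, so the interval function is set to \<open>0\<close> on the empty interval.\<close>
        let ?d = "\<lambda>K. if K = {} then 0 else norm (?\<Delta> K)"
        have nonempty: "K \<noteq> {}" if "(t, K) \<in> q" for t K
          using tagged_partial_division_ofD(2)[OF q that] by auto
        have "(\<Sum>(t,K)\<in>q. norm (?\<Delta> K)) = (\<Sum>(t,K)\<in>q. ?d K)"
          by (rule sum.cong) (use nonempty in auto)
        also have "\<dots> = (\<Sum>K\<in>snd ` q. ?d K)"
        proof (rule sum.over_tagged_division_lemma[OF tagged_partial_division_of_Union_self[OF q]])
          fix u v :: real assume "box u v = {}"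
          then have "v \<le> u" by simp
          then show "?d (cbox u v) = 0" by (cases "u = v") auto
        qed
        also have "\<dots> = (\<Sum>K\<in>snd ` q. norm (?\<Delta> K))"
          by (rule sum.cong) (use nonempty in auto)
        also have "\<dots> < e / 2"
        proof (rule \<delta>(2)[OF partial_division_of_tagged_division[OF q]])
          show "\<Union> (snd ` q) \<subseteq> {a..b}" using tagged_partial_division_ofD(3)[OF q] by fastforce
          show "(\<Sum>K\<in>snd ` q. Sup K - Inf K) < \<delta>"
            using partial_division_total_length_le[OF q sub G(3)] G(4) by fastforce
        qed
        finally show ?thesis .
      qed
      have off_N: "norm (measure lborel K *\<^sub>R h t - ?\<Delta> K) \<le> \<eta> * (Sup K - Inf K)"
        if "(t, K) \<in> p - q" for t K
      proof -
        from that have tK: "(t, K) \<in> p" "t \<notin> N" by (auto simp: q_def)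
        then obtain u v where K: "K = cbox u v" "t \<in> K" "K \<subseteq> {a..b}" using p by blast
        then have uv: "u \<le> v" "u \<le> t" "t \<le> v" by auto
        have near: "norm (y - t) < d t" if "y \<in> K" for y
          using fine tK that by (fastforce simp: fine_def \<gamma>_def dist_real_def)
        have "norm ((v - u) *\<^sub>R g t - (f v - f u))
            = norm ((f u - f t - (u - t) *\<^sub>R g t) - (f v - f t - (v - t) *\<^sub>R g t))"
          by (auto simp: algebra_simps)
        also have "\<dots> \<le> norm (f u - f t - (u - t) *\<^sub>R g t) + norm (f v - f t - (v - t) *\<^sub>R g t)"
          by (rule norm_triangle_ineq4)
        also have "\<dots> \<le> \<eta> * norm (u - t) + \<eta> * norm (v - t)"
        proof (intro add_mono d(2))
          show "norm (u - t) < d t" "norm (v - t) < d t" using near[of u] near[of v] K(1) uv by (simp_all del: real_norm_def)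
        qed (use K uv tK in auto)
        also have "\<dots> = \<eta> * (v - u)" using uv by (simp add: algebra_simps)
        finally show ?thesis using uv K tK by (simp add: h_def)
      qed
      have "(\<Sum>(t,K)\<in>p. measure lborel K *\<^sub>R h t) - (f b - f a) = (\<Sum>(t,K)\<in>p. measure lborel K *\<^sub>R h t - ?\<Delta> K)"
        unfolding tele(1) by (simp add: split_def sum_subtractf)
      also have "\<dots> = (\<Sum>(t,K)\<in>q. measure lborel K *\<^sub>R h t - ?\<Delta> K) + (\<Sum>(t,K)\<in>p - q. measure lborel K *\<^sub>R h t - ?\<Delta> K)"
        by (subst sum.subset_diff[OF \<open>q \<subseteq> p\<close> fin]) (rule add.commute)
      finally have "norm ((\<Sum>(t,K)\<in>p. measure lborel K *\<^sub>R h t) - (f b - f a))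
          \<le> norm (\<Sum>(t,K)\<in>q. measure lborel K *\<^sub>R h t - ?\<Delta> K) + norm (\<Sum>(t,K)\<in>p - q. measure lborel K *\<^sub>R h t - ?\<Delta> K)"
        by (simp add: norm_triangle_ineq)
      moreover have "norm (\<Sum>(t,K)\<in>q. measure lborel K *\<^sub>R h t - ?\<Delta> K) \<le> (\<Sum>(t,K)\<in>q. norm (?\<Delta> K))"
        by (rule sum_norm_le) (auto simp: q_def h_def norm_minus_commute)
      moreover have "norm (\<Sum>(t,K)\<in>p - q. measure lborel K *\<^sub>R h t - ?\<Delta> K) \<le> \<eta> * (b - a)"
      proof -
        have "norm (\<Sum>(t,K)\<in>p - q. measure lborel K *\<^sub>R h t - ?\<Delta> K) \<le> (\<Sum>(t,K)\<in>p - q. \<eta> * (Sup K - Inf K))"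
          by (rule sum_norm_le) (use off_N in auto)
        also have "\<dots> \<le> (\<Sum>(t,K)\<in>p. \<eta> * (Sup K - Inf K))"
        proof (rule sum_mono2[OF fin])
          fix tK assume "tK \<in> p - (p - q)"
          then obtain u v where "snd tK = cbox u v" "fst tK \<in> snd tK"
            using p tagged_division_ofD(2,4)[OF p, of "fst tK" "snd tK"] by auto
          then show "0 \<le> (case tK of (t, K) \<Rightarrow> \<eta> * (Sup K - Inf K))"
            using \<eta> by (auto simp: split_def)
        qed auto
        also have "\<dots> = \<eta> * (b - a)" by (simp add: tele(2) split_def sum_distrib_left)
        finally show ?thesis .
      qed
      ultimately show "norm ((\<Sum>(t,K)\<in>p. measure lborel K *\<^sub>R h t) - (f b - f a)) < e"
        using on_N \<eta>(2) by linarith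
    qed
  qed
  then have "(h has_integral (f b - f a)) {a..b}" unfolding cbox_interval .
  then show ?thesis by (rule has_integral_spike[OF N, rotated]) (simp add: h_def)
qed

lemma division_of_ends_mem:
  fixes K :: "real set"
  assumes "D division_of T" "K \<in> D"
  shows "Sup K \<in> T" "Inf K \<in> T"
proof -
  have "\<exists>u v. K = cbox u v" "K \<noteq> {}" "K \<subseteq> T" using division_ofD(2-4)[OF assms(1)] assms(2) by auto
  then have "Sup K \<in> K" "Inf K \<in> K" by auto
  with \<open>K \<subseteq> T\<close> show "Sup K \<in> T" "Inf K \<in> T" by auto
qed

lemma abs_cont_on_small_increment:
  fixes f :: "real \<Rightarrow> 'a::real_normed_vector"
  assumes "abs_cont_on {a..b} f" "e > 0"
  obtains \<delta> where "\<delta> > 0" "\<And>s t. s \<in> {a..b} \<Longrightarrow> t \<in> {a..b} \<Longrightarrow> \<bar>s - t\<bar> < \<delta> \<Longrightarrow> norm (f s - f t) < e"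
proof -
  obtain \<delta> where \<delta>: "\<delta> > 0" "\<And>D T. D division_of T \<Longrightarrow> T \<subseteq> {a..b} \<Longrightarrow> (\<Sum>K\<in>D. Sup K - Inf K) < \<delta> \<Longrightarrow>
        (\<Sum>K\<in>D. norm (f (Sup K) - f (Inf K))) < e"
    using abs_cont_onD[OF assms] by metis
  have *: "norm (f t - f s) < e" if "s \<le> t" "s \<in> {a..b}" "t \<in> {a..b}" "t - s < \<delta>" for s t
    using \<delta>(2)[OF division_of_self[of s t]] that by (simp add: cbox_interval)
  show ?thesis
  proof (rule that[OF \<delta>(1)])
    fix s t assume "s \<in> {a..b}" "t \<in> {a..b}" "\<bar>s - t\<bar> < \<delta>"
    then show "norm (f s - f t) < e"
      using *[of s t] *[of t s] by (cases "s \<le> t") (auto simp: norm_minus_commute)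
  qed
qed

lemma abs_cont_on_imp_continuous_on:
  fixes f :: "real \<Rightarrow> 'a::real_normed_vector"
  assumes "abs_cont_on {a..b} f"
  shows "continuous_on {a..b} f"
  unfolding continuous_on_iff
proof (intro ballI allI impI)
  fix t and e :: real assume "t \<in> {a..b}" "e > 0"
  obtain \<delta> where "\<delta> > 0" "\<And>s t. s \<in> {a..b} \<Longrightarrow> t \<in> {a..b} \<Longrightarrow> \<bar>s - t\<bar> < \<delta> \<Longrightarrow> norm (f s - f t) < e"
    using abs_cont_on_small_increment[OF assms \<open>e > 0\<close>] by metis
  with \<open>t \<in> {a..b}\<close> show "\<exists>d>0. \<forall>s\<in>{a..b}. dist s t < d \<longrightarrow> dist (f s) (f t) < e"
    by (auto simp: dist_norm)
qed

lemma abs_cont_on_mult: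
  fixes f g :: "real \<Rightarrow> 'a::real_normed_algebra"
  assumes f: "abs_cont_on {a..b} f" and g: "abs_cont_on {a..b} g"
  shows "abs_cont_on {a..b} (\<lambda>t. f t * g t)"
  unfolding abs_cont_on_def
proof (intro allI impI)
  fix e :: real assume "e > 0"
  have "bounded (f ` {a..b})" "bounded (g ` {a..b})"
    using f g by (auto intro!: compact_imp_bounded compact_continuous_image abs_cont_on_imp_continuous_on)
  then obtain C D where C: "C > 0" "\<And>t. t \<in> {a..b} \<Longrightarrow> norm (f t) \<le> C"
    and D: "D > 0" "\<And>t. t \<in> {a..b} \<Longrightarrow> norm (g t) \<le> D"
    unfolding bounded_pos by auto
  obtain \<delta>1 where \<delta>1: "\<delta>1 > 0" "\<And>P T. P division_of T \<Longrightarrow> T \<subseteq> {a..b} \<Longrightarrow> (\<Sum>K\<in>P. Sup K - Inf K) < \<delta>1 \<Longrightarrow>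
        (\<Sum>K\<in>P. norm (f (Sup K) - f (Inf K))) < e / (2 * D)"
    using abs_cont_onD[OF f, of "e / (2 * D)"] \<open>e > 0\<close> \<open>D > 0\<close> by auto
  obtain \<delta>2 where \<delta>2: "\<delta>2 > 0" "\<And>P T. P division_of T \<Longrightarrow> T \<subseteq> {a..b} \<Longrightarrow> (\<Sum>K\<in>P. Sup K - Inf K) < \<delta>2 \<Longrightarrow>
        (\<Sum>K\<in>P. norm (g (Sup K) - g (Inf K))) < e / (2 * C)"
    using abs_cont_onD[OF g, of "e / (2 * C)"] \<open>e > 0\<close> \<open>C > 0\<close> by auto
  show "\<exists>\<delta>>0. \<forall>P T. P division_of T \<and> T \<subseteq> {a..b} \<and> (\<Sum>K\<in>P. Sup K - Inf K) < \<delta> \<longrightarrow>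
      (\<Sum>K\<in>P. norm (f (Sup K) * g (Sup K) - f (Inf K) * g (Inf K))) < e"
  proof (intro exI[of _ "min \<delta>1 \<delta>2"] conjI allI impI)
    show "min \<delta>1 \<delta>2 > 0" using \<delta>1 \<delta>2 by simp
    fix P T assume P: "P division_of T \<and> T \<subseteq> {a..b} \<and> (\<Sum>K\<in>P. Sup K - Inf K) < min \<delta>1 \<delta>2"
    have "norm (f (Sup K) * g (Sup K) - f (Inf K) * g (Inf K))
        \<le> C * norm (g (Sup K) - g (Inf K)) + D * norm (f (Sup K) - f (Inf K))" if "K \<in> P" for K
    proof -
      have ends: "Sup K \<in> {a..b}" "Inf K \<in> {a..b}"
        using division_of_ends_mem[of P T K] P that by auto
      have "f (Sup K) * g (Sup K) - f (Inf K) * g (Inf K)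
          = f (Sup K) * (g (Sup K) - g (Inf K)) + (f (Sup K) - f (Inf K)) * g (Inf K)"
        by (simp add: algebra_simps)
      also have "norm \<dots> \<le> norm (f (Sup K)) * norm (g (Sup K) - g (Inf K))
          + norm (f (Sup K) - f (Inf K)) * norm (g (Inf K))"
        by (intro norm_triangle_le add_mono norm_mult_ineq)
      also have "\<dots> \<le> C * norm (g (Sup K) - g (Inf K)) + norm (f (Sup K) - f (Inf K)) * D"
        by (intro add_mono mult_right_mono mult_left_mono C D ends) auto
      finally show ?thesis by (simp add: mult.commute)
    qed
    then have "(\<Sum>K\<in>P. norm (f (Sup K) * g (Sup K) - f (Inf K) * g (Inf K)))
       \<le> (\<Sum>K\<in>P. C * norm (g (Sup K) - g (Inf K)) + D * norm (f (Sup K) - f (Inf K)))"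
      by (rule sum_mono)
    also have "\<dots> = C * (\<Sum>K\<in>P. norm (g (Sup K) - g (Inf K))) + D * (\<Sum>K\<in>P. norm (f (Sup K) - f (Inf K)))"
      by (simp add: sum.distrib sum_distrib_left)
    also have "\<dots> < C * (e / (2 * C)) + D * (e / (2 * D))"
      using P \<delta>1(2)[of P T] \<delta>2(2)[of P T]
      by (intro add_strict_mono mult_strict_left_mono C(1) D(1)) simp_all
    also have "\<dots> = e" using \<open>C > 0\<close> \<open>D > 0\<close> by simp
    finally show "(\<Sum>K\<in>P. norm (f (Sup K) * g (Sup K) - f (Inf K) * g (Inf K))) < e" .
  qed
qed

lemma abs_cont_on_diff:
  fixes f g :: "real \<Rightarrow> 'a::real_normed_vector"
  assumes f: "abs_cont_on S f" and g: "abs_cont_on S g"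
  shows "abs_cont_on S (\<lambda>t. f t - g t)"
  unfolding abs_cont_on_def
proof (intro allI impI)
  fix e :: real assume "e > 0"
  obtain \<delta>1 where \<delta>1: "\<delta>1 > 0" "\<And>P T. P division_of T \<Longrightarrow> T \<subseteq> S \<Longrightarrow> (\<Sum>K\<in>P. Sup K - Inf K) < \<delta>1 \<Longrightarrow>
        (\<Sum>K\<in>P. norm (f (Sup K) - f (Inf K))) < e / 2"
    using abs_cont_onD[OF f, of "e / 2"] \<open>e > 0\<close> by auto
  obtain \<delta>2 where \<delta>2: "\<delta>2 > 0" "\<And>P T. P division_of T \<Longrightarrow> T \<subseteq> S \<Longrightarrow> (\<Sum>K\<in>P. Sup K - Inf K) < \<delta>2 \<Longrightarrow>
        (\<Sum>K\<in>P. norm (g (Sup K) - g (Inf K))) < e / 2"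
    using abs_cont_onD[OF g, of "e / 2"] \<open>e > 0\<close> by auto
  show "\<exists>\<delta>>0. \<forall>P T. P division_of T \<and> T \<subseteq> S \<and> (\<Sum>K\<in>P. Sup K - Inf K) < \<delta> \<longrightarrow>
      (\<Sum>K\<in>P. norm (f (Sup K) - g (Sup K) - (f (Inf K) - g (Inf K)))) < e"
  proof (intro exI[of _ "min \<delta>1 \<delta>2"] conjI allI impI)
    show "min \<delta>1 \<delta>2 > 0" using \<delta>1 \<delta>2 by simp
    fix P T assume P: "P division_of T \<and> T \<subseteq> S \<and> (\<Sum>K\<in>P. Sup K - Inf K) < min \<delta>1 \<delta>2"
    have "(\<Sum>K\<in>P. norm (f (Sup K) - g (Sup K) - (f (Inf K) - g (Inf K))))
       \<le> (\<Sum>K\<in>P. norm (f (Sup K) - f (Inf K)) + norm (g (Sup K) - g (Inf K)))"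
    proof (rule sum_mono)
      fix K
      have eq: "f (Sup K) - g (Sup K) - (f (Inf K) - g (Inf K)) = (f (Sup K) - f (Inf K)) - (g (Sup K) - g (Inf K))"
        by simp
      show "norm (f (Sup K) - g (Sup K) - (f (Inf K) - g (Inf K)))
          \<le> norm (f (Sup K) - f (Inf K)) + norm (g (Sup K) - g (Inf K))"
        unfolding eq by (rule norm_triangle_ineq4)
    qed
    also have "\<dots> < e / 2 + e / 2"
      unfolding sum.distrib using P \<delta>1(2)[of P T] \<delta>2(2)[of P T]
      by (intro add_strict_mono) simp_all
    finally show "(\<Sum>K\<in>P. norm (f (Sup K) - g (Sup K) - (f (Inf K) - g (Inf K)))) < e" by simp
  qed
qed

section \<open>Classical solutions on an interval without centres\<close>

text \<open>
  A solution seen on a part \<open>S\<close> of the interval. The couplings are indexed by the position of the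
  centre, which makes it possible to say that two solutions with different coupling sequences
  solve the same problem on \<open>S\<close>, namely when the sequences agree at the centres in \<open>S\<close>.
\<close>
definition impulse_solution ::
  "real set \<Rightarrow> real set \<Rightarrow> (real \<Rightarrow> real) \<Rightarrow> (real \<Rightarrow> real) \<Rightarrow> complex \<Rightarrow> (real \<Rightarrow> complex) \<Rightarrow> bool" where
  "impulse_solution S M \<alpha> V z f \<longleftrightarrow>
     AC2_on (S - M) f \<and> tau_eq S V f (\<lambda>t. z * f t) \<and> (\<forall>t\<in>S \<inter> M. delta'_condition (\<alpha> t) t f)"

definition wronskian :: "(real \<Rightarrow> complex) \<Rightarrow> (real \<Rightarrow> complex) \<Rightarrow> real \<Rightarrow> complex" where
  "wronskian f g t = f t * D1 g t - D1 f t * g t"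

definition data_size :: "(real \<Rightarrow> complex) \<Rightarrow> real \<Rightarrow> real" where
  "data_size f t = cmod (f t) + cmod (D1 f t)"

lemma AC2_onD:
  assumes "AC2_on T f"
  shows "t \<in> T \<Longrightarrow> (f has_vector_derivative D1 f t) (at t)"
    and "{c..d} \<subseteq> T \<Longrightarrow> abs_cont_on {c..d} f"
    and "{c..d} \<subseteq> T \<Longrightarrow> abs_cont_on {c..d} (D1 f)"
  using assms unfolding AC2_on_def locally_abs_cont_on_def D1_def
  by (auto simp: vector_derivative_works[symmetric])

lemma tau_eqD:
  assumes "tau_eq S V f (\<lambda>t. z * f t)" "open S"
  obtains N where "negligible N"
    "\<And>t. t \<in> S - N \<Longrightarrow> (D1 f has_vector_derivative (complex_of_real (V t) - z) * f t) (at t)"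
proof -
  have S: "S \<inter> space lebesgue \<in> sets lebesgue" using assms(2) by simp
  have "AE t in lebesgue. t \<in> S \<longrightarrow> (\<exists>f2. (D1 f has_vector_derivative f2) (at t) \<and>
        z * f t = - f2 + complex_of_real (V t) * f t)"
    using assms(1) unfolding tau_eq_def AE_restrict_space_iff[OF S] .
  then obtain N where N: "N \<in> null_sets lebesgue"
    "{t \<in> space lebesgue. \<not> (t \<in> S \<longrightarrow> (\<exists>f2. (D1 f has_vector_derivative f2) (at t) \<and>
        z * f t = - f2 + complex_of_real (V t) * f t))} \<subseteq> N"
    unfolding eventually_ae_filter by blast
  show ?thesis
  proof (rule that[of N])
    show "negligible N" using N(1) negligible_iff_null_sets by blast
    fix t assume "t \<in> S - N"
    then obtain f2 where "(D1 f has_vector_derivative f2) (at t)" "z * f t = - f2 + complex_of_real (V t) * f t"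
      using N(2) by auto
    moreover from this have "f2 = (complex_of_real (V t) - z) * f t" by (simp add: algebra_simps)
    ultimately show "(D1 f has_vector_derivative (complex_of_real (V t) - z) * f t) (at t)" by simp
  qed
qed

lemma solution_integral_equations:
  assumes f: "AC2_on T f" "tau_eq S V f (\<lambda>t. z * f t)" and S: "open S" and cd: "c \<le> d" "{c..d} \<subseteq> T" "{c..d} \<subseteq> S"
  shows "(D1 f has_integral f d - f c) {c..d}"
    and "((\<lambda>t. (complex_of_real (V t) - z) * f t) has_integral D1 f d - D1 f c) {c..d}"
proof -
  show "(D1 f has_integral f d - f c) {c..d}"
    using AC2_onD(2)[OF f(1) cd(2)] has_vector_derivative_at_within[OF AC2_onD(1)[OF f(1)]] cd
    by (intro abs_cont_on_fundamental_theorem[where N = "{}"]) auto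
  obtain N where N: "negligible N"
    "\<And>t. t \<in> S - N \<Longrightarrow> (D1 f has_vector_derivative (complex_of_real (V t) - z) * f t) (at t)"
    using tau_eqD[OF f(2) S] by metis
  show "((\<lambda>t. (complex_of_real (V t) - z) * f t) has_integral D1 f d - D1 f c) {c..d}"
  proof (rule abs_cont_on_fundamental_theorem[OF cd(1) AC2_onD(3)[OF f(1) cd(2)] N(1)])
    fix t assume "t \<in> {c..d} - N"
    then show "(D1 f has_vector_derivative (complex_of_real (V t) - z) * f t) (at t within {c..d})"
      using cd(3) by (intro has_vector_derivative_at_within[OF N(2)]) auto
  qed
qed

text \<open>
  Substituting the differential equation for \<open>f''\<close> and \<open>g''\<close> shows that the Wronskian has derivative
  \<open>0\<close> almost everywhere; being absolutely continuous, it is then constant.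
\<close>
lemma wronskian_constant_on_interval:
  assumes f: "AC2_on T f" "tau_eq S V f (\<lambda>t. z * f t)"
    and g: "AC2_on T g" "tau_eq S V g (\<lambda>t. z * g t)"
    and S: "open S" and cd: "c \<le> d" "{c..d} \<subseteq> T" "{c..d} \<subseteq> S"
  shows "wronskian f g c = wronskian f g d"
proof -
  obtain N1 where N1: "negligible N1"
    "\<And>t. t \<in> S - N1 \<Longrightarrow> (D1 f has_vector_derivative (complex_of_real (V t) - z) * f t) (at t)"
    using tau_eqD[OF f(2) S] by metis
  obtain N2 where N2: "negligible N2"
    "\<And>t. t \<in> S - N2 \<Longrightarrow> (D1 g has_vector_derivative (complex_of_real (V t) - z) * g t) (at t)"
    using tau_eqD[OF g(2) S] by metis
  have "((\<lambda>t. 0) has_integral (wronskian f g d - wronskian f g c)) {c..d}"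
  proof (rule abs_cont_on_fundamental_theorem[OF cd(1)])
    show "abs_cont_on {c..d} (wronskian f g)"
      unfolding wronskian_def[abs_def]
      using AC2_onD(2,3)[OF f(1) cd(2)] AC2_onD(2,3)[OF g(1) cd(2)]
      by (intro abs_cont_on_diff abs_cont_on_mult)
    show "negligible (N1 \<union> N2)" using N1 N2 by (simp add: negligible_Un)
    fix t assume t: "t \<in> {c..d} - (N1 \<union> N2)"
    then have "(wronskian f g has_vector_derivative
        (f t * ((complex_of_real (V t) - z) * g t) + D1 f t * D1 g t)
        - (D1 f t * D1 g t + (complex_of_real (V t) - z) * f t * g t)) (at t)"
      unfolding wronskian_def[abs_def] using cd AC2_onD(1)[OF f(1)] AC2_onD(1)[OF g(1)]
      by (intro has_vector_derivative_diff has_vector_derivative_mult N1(2) N2(2)) auto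
    then show "(wronskian f g has_vector_derivative 0) (at t within {c..d})"
      by (auto intro: has_vector_derivative_at_within simp: algebra_simps)
  qed
  then show ?thesis using has_integral_unique[OF has_integral_0] by fastforce
qed

text \<open>
  The integral equations for \<open>f\<close> and \<open>f'\<close>, with \<open>\<bar>f\<bar> + \<bar>f'\<bar> \<le> m\<close> inserted in the integrands.
\<close>
lemma data_variation_le:
  assumes f: "AC2_on T f" "tau_eq S V f (\<lambda>t. z * f t)"
    and S: "open S" and cd: "c \<le> d" "{c..d} \<subseteq> T" "{c..d} \<subseteq> S"
    and V: "V absolutely_integrable_on {c..d}"
    and m: "\<And>t. t \<in> {c..d} \<Longrightarrow> data_size f t \<le> m"
  shows "cmod (f d - f c) + cmod (D1 f d - D1 f c) \<le> m * integral {c..d} (\<lambda>t. 1 + cmod z + \<bar>V t\<bar>)"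
proof -
  note eqs = solution_integral_equations[OF f S cd]
  have V': "(\<lambda>t. \<bar>V t\<bar>) integrable_on {c..d}"
    using V by (simp add: absolutely_integrable_on_def)
  then have q: "(\<lambda>t. cmod z + \<bar>V t\<bar>) integrable_on {c..d}"
    by (intro integrable_add) auto
  have "cmod (integral {c..d} (D1 f)) \<le> integral {c..d} (\<lambda>t. m)"
  proof (rule Henstock_Kurzweil_Integration.integral_norm_bound_integral)
    show "D1 f integrable_on {c..d}" using eqs(1) by blast
    show "cmod (D1 f t) \<le> m" if "t \<in> {c..d}" for t
      using m[OF that] norm_ge_zero[of "f t"] unfolding data_size_def by linarith
  qed auto
  moreover have "cmod (integral {c..d} (\<lambda>t. (complex_of_real (V t) - z) * f t))
      \<le> integral {c..d} (\<lambda>t. m * (cmod z + \<bar>V t\<bar>))"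
  proof (rule Henstock_Kurzweil_Integration.integral_norm_bound_integral)
    show "(\<lambda>t. (complex_of_real (V t) - z) * f t) integrable_on {c..d}" using eqs(2) by blast
    show "(\<lambda>t. m * (cmod z + \<bar>V t\<bar>)) integrable_on {c..d}"
      using integrable_on_cmult_left[OF q, of m] by simp
    show "cmod ((complex_of_real (V t) - z) * f t) \<le> m * (cmod z + \<bar>V t\<bar>)" if "t \<in> {c..d}" for t
    proof -
      have "cmod (f t) \<le> m"
        using m[OF that] norm_ge_zero[of "D1 f t"] unfolding data_size_def by linarith
      moreover have "cmod (complex_of_real (V t) - z) \<le> cmod z + \<bar>V t\<bar>"
        using norm_triangle_ineq4[of "complex_of_real (V t)" z] by simp
      ultimately have "cmod (complex_of_real (V t) - z) * cmod (f t) \<le> (cmod z + \<bar>V t\<bar>) * m"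
        by (intro mult_mono) auto
      then show ?thesis by (simp add: norm_mult mult.commute)
    qed
  qed
  moreover have "integral {c..d} (\<lambda>t. m) + integral {c..d} (\<lambda>t. m * (cmod z + \<bar>V t\<bar>))
      = m * integral {c..d} (\<lambda>t. 1 + cmod z + \<bar>V t\<bar>)"
  proof -
    have "integral {c..d} (\<lambda>t. 1 + cmod z + \<bar>V t\<bar>) = (d - c) + integral {c..d} (\<lambda>t. cmod z + \<bar>V t\<bar>)"
      using integral_add[OF integrable_const_ivl q, of 1] cd(1) by (simp add: add.assoc)
    moreover have "integral {c..d} (\<lambda>t. m * (cmod z + \<bar>V t\<bar>)) = m * integral {c..d} (\<lambda>t. cmod z + \<bar>V t\<bar>)"
      by (rule integral_mult_right)
    moreover have "integral {c..d} (\<lambda>t. m) = m * (d - c)" using cd(1) by simp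
    ultimately show ?thesis by (simp only: distrib_left)
  qed
  ultimately show ?thesis using eqs by (simp add: integral_unique)
qed

text \<open>
  A Harnack-type inequality, used in place of a uniqueness theorem. Where the weight has integral
  at most \<open>1/2\<close>, the maximum \<open>m\<close> of the data exceeds any other value by at most \<open>m/2\<close>. Being
  uniform up to the ends of the interval, the bound survives passage to one-sided limits at a
  centre.
\<close>
lemma data_size_comparable:
  assumes f: "AC2_on T f" "tau_eq S V f (\<lambda>t. z * f t)"
    and S: "open S" and cd: "{c..d} \<subseteq> T" "{c..d} \<subseteq> S"
    and V: "V absolutely_integrable_on {c..d}"
    and small: "integral {c..d} (\<lambda>t. 1 + cmod z + \<bar>V t\<bar>) \<le> 1/2"
    and s: "s \<in> {c..d}" and t: "t \<in> {c..d}"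
  shows "data_size f t \<le> 2 * data_size f s"
proof -
  have cont: "continuous_on {c..d} (data_size f)"
    unfolding data_size_def[abs_def] using AC2_onD(2,3)[OF f(1) cd(1)]
    by (intro continuous_intros abs_cont_on_imp_continuous_on)
  obtain y where y: "y \<in> {c..d}" "\<And>t. t \<in> {c..d} \<Longrightarrow> data_size f t \<le> data_size f y"
    using continuous_attains_sup[OF compact_Icc _ cont] s by blast
  let ?m = "data_size f y"
  have "?m \<ge> 0" by (simp add: data_size_def)
  have int: "(\<lambda>t. 1 + cmod z + \<bar>V t\<bar>) integrable_on {c..d}"
    using V by (intro integrable_add) (auto simp: absolutely_integrable_on_def)
  have var: "cmod (f d' - f c') + cmod (D1 f d' - D1 f c') \<le> ?m / 2"
    if "c' \<in> {c..d}" "d' \<in> {c..d}" "c' \<le> d'" for c' d'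
  proof -
    have sub: "{c'..d'} \<subseteq> {c..d}" using that by auto
    have "V absolutely_integrable_on {c'..d'}"
      using V sub by (rule absolutely_integrable_on_subinterval)
    then have "cmod (f d' - f c') + cmod (D1 f d' - D1 f c')
        \<le> ?m * integral {c'..d'} (\<lambda>t. 1 + cmod z + \<bar>V t\<bar>)"
      using sub cd that y(2) by (intro data_variation_le[OF f S]) auto
    also have "\<dots> \<le> ?m * integral {c..d} (\<lambda>t. 1 + cmod z + \<bar>V t\<bar>)"
      using \<open>?m \<ge> 0\<close> sub integrable_on_subinterval[OF int sub] int
      by (intro mult_left_mono integral_subset_le) auto
    also have "\<dots> \<le> ?m * (1/2)" using small \<open>?m \<ge> 0\<close> by (rule mult_left_mono)
    finally show ?thesis by simp
  qed
  have "cmod (f y - f s) + cmod (D1 f y - D1 f s) \<le> ?m / 2"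
    using var[of s y] var[of y s] s y(1) by (cases "s \<le> y") (auto simp: norm_minus_commute)
  moreover have "?m \<le> data_size f s + (cmod (f y - f s) + cmod (D1 f y - D1 f s))"
    using norm_triangle_sub[of "f y" "f s"] norm_triangle_sub[of "D1 f y" "D1 f s"]
    by (simp add: data_size_def)
  ultimately show ?thesis using y(2)[OF t] by linarith
qed

lemma small_integral_near_point:
  fixes q :: "real \<Rightarrow> real"
  assumes q: "q integrable_on {c..d}" and t: "c < t" "t < d" and "e > 0"
  obtains \<delta> where "\<delta> > 0" "{t - \<delta>..t + \<delta>} \<subseteq> {c..d}"
    "\<And>r s. r \<le> s \<Longrightarrow> {r..s} \<subseteq> {t - \<delta><..<t + \<delta>} \<Longrightarrow> integral {r..s} q \<le> e"
proof -
  have "continuous_on {c..d} (\<lambda>x. integral {c..x} q)" by (rule indefinite_integral_continuous_1[OF q])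
  then obtain \<delta>0 where \<delta>0: "\<delta>0 > 0"
    "\<And>s. s \<in> {c..d} \<Longrightarrow> dist s t < \<delta>0 \<Longrightarrow> dist (integral {c..s} q) (integral {c..t} q) < e/2"
    using t \<open>e > 0\<close> unfolding continuous_on_iff by (metis atLeastAtMost_iff half_gt_zero less_imp_le)
  define \<delta> where "\<delta> = min \<delta>0 (min (t - c) (d - t))"
  show ?thesis
  proof (rule that[of \<delta>])
    show "\<delta> > 0" "{t - \<delta>..t + \<delta>} \<subseteq> {c..d}" using \<delta>0 t by (auto simp: \<delta>_def)
    fix r s assume rs: "r \<le> s" "{r..s} \<subseteq> {t - \<delta><..<t + \<delta>}"
    then have "t - \<delta> < r" "s < t + \<delta>" by auto
    with rs(1) have *: "r \<in> {c..d}" "s \<in> {c..d}" "dist r t < \<delta>0" "dist s t < \<delta>0"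
      unfolding \<delta>_def dist_real_def by auto
    have "integral {c..s} q = integral {c..r} q + integral {r..s} q"
      using * rs(1) integrable_on_subinterval[OF q, of c s]
      by (intro Henstock_Kurzweil_Integration.integral_combine[symmetric]) auto
    then show "integral {r..s} q \<le> e"
      using \<delta>0(2)[OF *(1,3)] \<delta>0(2)[OF *(2,4)] unfolding dist_real_def by linarith
  qed
qed

text \<open>
  Continuation across exceptional points. It is applied to the Wronskian and to the truth value of
  ``the initial data vanish here'', neither of which has a meaningful value at a centre.
\<close>
lemma locally_constant_off_set:
  fixes W :: "real \<Rightarrow> 'b"
  assumes S: "open S" "connected S"
    and loc: "\<And>t. t \<in> S \<Longrightarrow> \<exists>w. (\<forall>\<^sub>F s in at t. W s = w) \<and> (t \<notin> M \<longrightarrow> W t = w)"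
    and s: "s \<in> S - M" and t: "t \<in> S - M"
  shows "W s = W t"
proof -
  have "\<exists>w. \<forall>t\<in>S. (\<forall>\<^sub>F s in at t. W s = w t) \<and> (t \<notin> M \<longrightarrow> W t = w t)"
    by (rule bchoice) (rule ballI, rule loc)
  then obtain w where "\<forall>t\<in>S. (\<forall>\<^sub>F s in at t. W s = w t) \<and> (t \<notin> M \<longrightarrow> W t = w t)" ..
  then have w: "\<forall>\<^sub>F s in at t. W s = w t" "t \<notin> M \<Longrightarrow> W t = w t" if "t \<in> S" for t
    using that by auto
  have "w s = w t"
  proof (rule connected_local_const[OF S(2)])
    show "\<forall>t\<in>S. \<forall>\<^sub>F s in at t within S. w t = w s"
    proof
      fix t assume t: "t \<in> S"
      then obtain U where U: "open U" "t \<in> U" "\<And>s. s \<in> U \<Longrightarrow> s \<noteq> t \<Longrightarrow> W s = w t"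
        using w(1)[OF t] unfolding eventually_at_topological by blast
      have "w t = w s" if s: "s \<in> U \<inter> S" for s
      proof (cases "s = t")
        case False
        have "\<forall>\<^sub>F r in at s. r \<in> U - {t}"
          using s False U(1) by (intro eventually_at_in_open') auto
        moreover have "\<forall>\<^sub>F r in at s. W r = w s" using w(1)[of s] s by simp
        ultimately have "\<forall>\<^sub>F r in at s. w t = w s"
        proof eventually_elim
          case (elim r)
          then show ?case using U(3)[of r] by simp
        qed
        then show ?thesis by simp
      qed simp
      then show "\<forall>\<^sub>F s in at t within S. w t = w s"
        using U unfolding eventually_at_topological by blast
    qed
  qed (use s t in auto)
  with w(2)[of s] w(2)[of t] s t show ?thesis by simp
qed

section \<open>Solutions on an interval with point interactions\<close>

locale impulse_interval =
  fixes S M :: "real set" and V :: "real \<Rightarrow> real"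
  assumes open_S: "open S" and connected_S: "connected S"
    and no_limpt: "t \<in> S \<Longrightarrow> \<not> t islimpt M"
    and V_int: "locally_integrable_on S V"
begin

text \<open>
  Around each point there is an interval on which the data of solutions are comparable and whose
  only possible centre is the point itself.
\<close>
lemma regular_window:
  assumes "t \<in> S"
  shows "\<exists>\<delta>>0. {t - \<delta><..<t + \<delta>} \<subseteq> S \<and> {t - \<delta><..<t + \<delta>} - {t} \<subseteq> S - M \<and>
    (\<forall>c d. c \<le> d \<longrightarrow> {c..d} \<subseteq> {t - \<delta><..<t + \<delta>} \<longrightarrow> V absolutely_integrable_on {c..d} \<and>
       integral {c..d} (\<lambda>s. 1 + cmod z + \<bar>V s\<bar>) \<le> 1/2)"
proof -
  obtain e where e: "e > 0" "cball t e \<subseteq> S" using open_S assms open_contains_cball by metis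
  then have sub: "{t - e..t + e} \<subseteq> S" by (simp add: cball_eq_atLeastAtMost)
  then have V: "V absolutely_integrable_on {t - e..t + e}"
    using V_int unfolding locally_integrable_on_def by blast
  then have "(\<lambda>s. 1 + cmod z + \<bar>V s\<bar>) integrable_on {t - e..t + e}"
    by (intro integrable_add) (auto simp: absolutely_integrable_on_def)
  then obtain \<delta>1 where \<delta>1: "\<delta>1 > 0" "{t - \<delta>1..t + \<delta>1} \<subseteq> {t - e..t + e}"
    "\<And>r s. r \<le> s \<Longrightarrow> {r..s} \<subseteq> {t - \<delta>1<..<t + \<delta>1} \<Longrightarrow> integral {r..s} (\<lambda>s. 1 + cmod z + \<bar>V s\<bar>) \<le> 1/2"
    using small_integral_near_point[of _ "t - e" "t + e" t "1/2"] e(1) by auto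
  obtain \<delta>2 where \<delta>2: "\<delta>2 > 0" "\<And>s. s \<in> M \<Longrightarrow> s \<noteq> t \<Longrightarrow> \<not> dist s t < \<delta>2"
    using no_limpt[OF assms] unfolding islimpt_approachable by auto
  let ?W = "{t - min \<delta>1 \<delta>2<..<t + min \<delta>1 \<delta>2}"
  have inside: "?W \<subseteq> {t - \<delta>1<..<t + \<delta>1}" "?W \<subseteq> {t - \<delta>1..t + \<delta>1}" by auto
  have S: "?W \<subseteq> S" using inside(2) \<delta>1(2) sub by blast
  have M: "?W - {t} \<subseteq> S - M"
  proof
    fix s assume s: "s \<in> ?W - {t}"
    then have "dist s t < \<delta>2" by (auto simp: dist_real_def)
    with s S \<delta>2(2)[of s] show "s \<in> S - M" by auto
  qed
  have small: "V absolutely_integrable_on {c..d} \<and> integral {c..d} (\<lambda>s. 1 + cmod z + \<bar>V s\<bar>) \<le> 1/2"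
    if cd: "c \<le> d" "{c..d} \<subseteq> ?W" for c d
  proof -
    have "{c..d} \<subseteq> {t - \<delta>1<..<t + \<delta>1}" using cd(2) inside(1) by (rule subset_trans)
    moreover have "{c..d} \<subseteq> {t - e..t + e}" using cd(2) inside(2) \<delta>1(2) by (meson subset_trans)
    ultimately show ?thesis
      using \<delta>1(3)[OF cd(1)] absolutely_integrable_on_subinterval[OF V] by blast
  qed
  have "min \<delta>1 \<delta>2 > 0" using \<delta>1 \<delta>2 by simp
  with S M small show ?thesis by blast
qed

lemma open_regular_points: "open (S - M)"
  unfolding open_contains_ball
proof
  fix t assume t: "t \<in> S - M"
  obtain \<delta> where "\<delta> > 0" "{t - \<delta><..<t + \<delta>} - {t} \<subseteq> S - M" using regular_window[of t undefined] t by blast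
  then show "\<exists>e>0. ball t e \<subseteq> S - M" using t by (intro exI[of _ \<delta>]) (auto simp: ball_eq_greaterThanLessThan)
qed

lemma isCont_regular_point:
  assumes f: "AC2_on (S - M) f" and t: "t \<in> S - M"
  shows "isCont f t" "isCont (D1 f) t"
proof -
  show "isCont f t" using AC2_onD(1)[OF f t] has_vector_derivative_continuous by blast
  obtain e where e: "e > 0" "cball t e \<subseteq> S - M"
    using open_regular_points t open_contains_cball by metis
  then have "continuous_on {t - e..t + e} (D1 f)"
    using AC2_onD(3)[OF f] by (intro abs_cont_on_imp_continuous_on) (simp add: cball_eq_atLeastAtMost)
  then show "isCont (D1 f) t" using e(1) by (intro continuous_on_interior) auto
qed

text \<open>
  Points that are not centres are treated as centres with coupling \<open>0\<close>, so that later arguments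
  need not distinguish the two cases.
\<close>
lemma one_sided_limits:
  assumes f: "impulse_solution S M \<alpha> V z f" and t: "t \<in> S"
  shows "\<exists>u v d. (f \<longlongrightarrow> u) (at_left t) \<and> (f \<longlongrightarrow> v) (at_right t) \<and>
    (D1 f \<longlongrightarrow> d) (at_left t) \<and> (D1 f \<longlongrightarrow> d) (at_right t) \<and>
    v - u = complex_of_real (if t \<in> M then \<alpha> t else 0) * d \<and>
    (t \<notin> M \<longrightarrow> f t = u \<and> f t = v \<and> D1 f t = d)"
proof (cases "t \<in> M")
  case True
  then have "delta'_condition (\<alpha> t) t f" using f t by (auto simp: impulse_solution_def)
  then obtain u v d where "(f \<longlongrightarrow> u) (at_left t)" "(f \<longlongrightarrow> v) (at_right t)"
    "(D1 f \<longlongrightarrow> d) (at_left t)" "(D1 f \<longlongrightarrow> d) (at_right t)" "v - u = complex_of_real (\<alpha> t) * d"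
    unfolding delta'_condition_def by blast
  with True show ?thesis by (intro exI[of _ u] exI[of _ v] exI[of _ d]) simp
next
  case False
  with f t have "isCont f t" "isCont (D1 f) t"
    using isCont_regular_point[of f t] by (auto simp: impulse_solution_def)
  with False show ?thesis
    unfolding isCont_def filterlim_at_split
    by (intro exI[of _ "f t"] exI[of _ "f t"] exI[of _ "D1 f t"]) simp
qed

text \<open>
  If both functions jump by \<open>\<alpha>\<close> times their derivative, the Wronskian jumps by
  \<open>\<alpha> f' g' - f' \<alpha> g' = 0\<close>.
\<close>
lemma wronskian_locally_constant:
  assumes f: "impulse_solution S M \<alpha> V z f" and g: "impulse_solution S M \<alpha> V z g" and t: "t \<in> S"
  shows "\<exists>w. (\<forall>\<^sub>F s in at t. wronskian f g s = w) \<and> (t \<notin> M \<longrightarrow> wronskian f g t = w)"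
proof -
  obtain \<delta> where \<delta>: "\<delta> > 0" "{t - \<delta><..<t + \<delta>} - {t} \<subseteq> S - M" using regular_window[OF t, of undefined] by blast
  have const: "wronskian f g c = wronskian f g d" if "c \<le> d" "{c..d} \<subseteq> S - M" for c d
  proof (rule wronskian_constant_on_interval[where T = "S - M" and S = S and V = V and z = z])
    show "AC2_on (S - M) f" "tau_eq S V f (\<lambda>t. z * f t)" "AC2_on (S - M) g" "tau_eq S V g (\<lambda>t. z * g t)"
      using f g by (simp_all add: impulse_solution_def)
    show "{c..d} \<subseteq> S" using that by blast
  qed (fact open_S that)+
  have const': "wronskian f g s = wronskian f g s'" if "{min s s'..max s s'} \<subseteq> S - M" for s s'
  proof (cases "s \<le> s'")
    case True
    then show ?thesis using const[of s s'] that by simp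
  next
    case False
    then show ?thesis using const[of s' s] that by simp
  qed
  obtain u v d where F: "(f \<longlongrightarrow> u) (at_left t)" "(f \<longlongrightarrow> v) (at_right t)"
    "(D1 f \<longlongrightarrow> d) (at_left t)" "(D1 f \<longlongrightarrow> d) (at_right t)"
    "v - u = complex_of_real (if t \<in> M then \<alpha> t else 0) * d"
    "t \<notin> M \<longrightarrow> f t = u \<and> f t = v \<and> D1 f t = d"
    using one_sided_limits[OF f t] by blast
  obtain u' v' d' where G: "(g \<longlongrightarrow> u') (at_left t)" "(g \<longlongrightarrow> v') (at_right t)"
    "(D1 g \<longlongrightarrow> d') (at_left t)" "(D1 g \<longlongrightarrow> d') (at_right t)"
    "v' - u' = complex_of_real (if t \<in> M then \<alpha> t else 0) * d'"
    "t \<notin> M \<longrightarrow> g t = u' \<and> g t = v' \<and> D1 g t = d'"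
    using one_sided_limits[OF g t] by blast
  define w where "w = u * d' - d * u'"
  have left: "wronskian f g s = w" if s: "s \<in> {t - \<delta><..<t}" for s
  proof -
    have "\<forall>\<^sub>F r in at_left t. r \<in> {t - \<delta><..<t}"
      using \<delta>(1) by (intro eventually_at_left_real) simp
    then have "\<forall>\<^sub>F r in at_left t. wronskian f g r = wronskian f g s"
    proof eventually_elim
      case (elim r)
      show ?case
      proof (rule const')
        have "{min r s..max r s} \<subseteq> {t - \<delta><..<t + \<delta>} - {t}" using elim s \<delta>(1) by auto
        then show "{min r s..max r s} \<subseteq> S - M" using \<delta>(2) by blast
      qed
    qed
    then have "(wronskian f g \<longlongrightarrow> wronskian f g s) (at_left t)" by (rule tendsto_eventually)
    moreover have "(wronskian f g \<longlongrightarrow> w) (at_left t)"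
      unfolding wronskian_def[abs_def] w_def by (intro tendsto_intros F G)
    ultimately show ?thesis using tendsto_unique trivial_limit_at_left_real by blast
  qed
  have right: "wronskian f g s = w" if s: "s \<in> {t<..<t + \<delta>}" for s
  proof -
    have "\<forall>\<^sub>F r in at_right t. r \<in> {t<..<t + \<delta>}"
      using \<delta>(1) by (intro eventually_at_right_real) simp
    then have "\<forall>\<^sub>F r in at_right t. wronskian f g r = wronskian f g s"
    proof eventually_elim
      case (elim r)
      show ?case
      proof (rule const')
        have "{min r s..max r s} \<subseteq> {t - \<delta><..<t + \<delta>} - {t}" using elim s \<delta>(1) by auto
        then show "{min r s..max r s} \<subseteq> S - M" using \<delta>(2) by blast
      qed
    qed
    then have "(wronskian f g \<longlongrightarrow> wronskian f g s) (at_right t)" by (rule tendsto_eventually)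
    moreover have "(wronskian f g \<longlongrightarrow> v * d' - d * v') (at_right t)"
      unfolding wronskian_def[abs_def] by (intro tendsto_intros F G)
    ultimately have "wronskian f g s = v * d' - d * v'"
      using tendsto_unique trivial_limit_at_right_real by blast
    also have "\<dots> = w + (v - u) * d' - d * (v' - u')" by (simp add: w_def algebra_simps)
    also have "\<dots> = w" by (simp only: F(5) G(5)) simp
    finally show ?thesis .
  qed
  have "\<forall>\<^sub>F s in at t. wronskian f g s = w"
    unfolding eventually_at
  proof (intro exI[of _ \<delta>] conjI ballI impI \<delta>(1))
    fix s assume "s \<noteq> t \<and> dist s t < \<delta>"
    then show "wronskian f g s = w" using left[of s] right[of s] by (cases "s < t") (auto simp: dist_real_def)
  qed
  moreover have "wronskian f g t = w" if "t \<notin> M"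
    using F(6) G(6) that by (simp add: wronskian_def w_def)
  ultimately show ?thesis by blast
qed

lemma wronskian_constant:
  assumes "impulse_solution S M \<alpha> V z f" "impulse_solution S M \<alpha> V z g" "s \<in> S - M" "t \<in> S - M"
  shows "wronskian f g s = wronskian f g t"
  using wronskian_locally_constant[OF assms(1,2)] locally_constant_off_set[OF open_S connected_S] assms(3,4)
  by blast

lemma data_size_zero_iff_limit_zero:
  assumes f: "impulse_solution S M \<alpha> V z f"
    and u: "(f \<longlongrightarrow> u) F" and d: "(D1 f \<longlongrightarrow> d) F" and F: "F \<noteq> bot" "\<forall>\<^sub>F r in F. r \<in> A"
    and A: "\<And>r s. r \<in> A \<Longrightarrow> s \<in> A \<Longrightarrow> data_size f r \<le> 2 * data_size f s" and s: "s \<in> A"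
  shows "data_size f s = 0 \<longleftrightarrow> u = 0 \<and> d = 0"
proof -
  have lim: "(data_size f \<longlongrightarrow> cmod u + cmod d) F"
    unfolding data_size_def[abs_def] by (intro tendsto_intros u d)
  have "data_size f s \<le> 2 * (cmod u + cmod d)"
  proof (rule tendsto_lowerbound[OF tendsto_mult[OF tendsto_const lim] _ F(1)])
    show "\<forall>\<^sub>F r in F. data_size f s \<le> 2 * data_size f r"
      using F(2) by eventually_elim (use A s in blast)
  qed
  moreover have "cmod u + cmod d \<le> 2 * data_size f s"
  proof (rule tendsto_upperbound[OF lim _ F(1)])
    show "\<forall>\<^sub>F r in F. data_size f r \<le> 2 * data_size f s"
      using F(2) by eventually_elim (use A s in blast)
  qed
  moreover have "data_size f s \<ge> 0" by (simp add: data_size_def)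
  ultimately have "data_size f s = 0 \<longleftrightarrow> cmod u + cmod d = 0"
    using norm_ge_zero[of u] norm_ge_zero[of d] by (smt (verit))
  then show ?thesis by (simp add: add_nonneg_eq_0_iff)
qed

text \<open>
  Zero data on one side of \<open>t\<close> propagate to zero limits at \<open>t\<close>, through the jump condition to zero
  limits on the other side, and from there to zero data on that side. Each step is reversible.
\<close>
lemma data_size_zero_locally_constant:
  assumes f: "impulse_solution S M \<alpha> V z f" and t: "t \<in> S"
    and u: "(f \<longlongrightarrow> u) (at_left t)" and d: "(D1 f \<longlongrightarrow> d) (at_left t)"
  defines "w \<equiv> u = 0 \<and> d = 0"
  shows "(\<forall>\<^sub>F s in at t. (data_size f s = 0) = w) \<and> (t \<notin> M \<longrightarrow> (data_size f t = 0) = w)"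
proof -
  obtain \<delta> where \<delta>: "\<delta> > 0" "{t - \<delta><..<t + \<delta>} \<subseteq> S" "{t - \<delta><..<t + \<delta>} - {t} \<subseteq> S - M"
    "\<And>c d. c \<le> d \<Longrightarrow> {c..d} \<subseteq> {t - \<delta><..<t + \<delta>} \<Longrightarrow> V absolutely_integrable_on {c..d} \<and>
       integral {c..d} (\<lambda>s. 1 + cmod z + \<bar>V s\<bar>) \<le> 1/2"
    using regular_window[OF t, of z] by blast
  have comparable: "data_size f r \<le> 2 * data_size f s"
    if "{min r s..max r s} \<subseteq> {t - \<delta><..<t + \<delta>} - {t}" for r s
  proof (rule data_size_comparable)
    show "AC2_on (S - M) f" "tau_eq S V f (\<lambda>t. z * f t)" using f by (auto simp: impulse_solution_def)
    show "open S" by (rule open_S)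
    show "{min r s..max r s} \<subseteq> S - M" "{min r s..max r s} \<subseteq> S" using that \<delta> by auto
    have "min r s \<le> max r s" "{min r s..max r s} \<subseteq> {t - \<delta><..<t + \<delta>}" using that by (simp, blast)
    then show "V absolutely_integrable_on {min r s..max r s}"
      "integral {min r s..max r s} (\<lambda>s. 1 + cmod z + \<bar>V s\<bar>) \<le> 1/2"
      using \<delta>(4) by blast+
  qed auto
  obtain u' v' d' where F: "(f \<longlongrightarrow> u') (at_left t)" "(f \<longlongrightarrow> v') (at_right t)"
    "(D1 f \<longlongrightarrow> d') (at_left t)" "(D1 f \<longlongrightarrow> d') (at_right t)"
    "v' - u' = complex_of_real (if t \<in> M then \<alpha> t else 0) * d'"
    "t \<notin> M \<longrightarrow> f t = u' \<and> f t = v' \<and> D1 f t = d'"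
    using one_sided_limits[OF f t] by blast
  have ud: "u' = u" "d' = d"
    using tendsto_unique[OF trivial_limit_at_left_real] u d F by blast+
  have left: "(data_size f s = 0) = w" if s: "s \<in> {t - \<delta><..<t}" for s
    unfolding w_def
  proof (rule data_size_zero_iff_limit_zero[OF f u d trivial_limit_at_left_real _ _ s])
    show "\<forall>\<^sub>F r in at_left t. r \<in> {t - \<delta><..<t}" using \<delta>(1) by (intro eventually_at_left_real) simp
    show "data_size f r \<le> 2 * data_size f s" if "r \<in> {t - \<delta><..<t}" "s \<in> {t - \<delta><..<t}" for r s
      using that \<delta>(1) by (intro comparable) auto
  qed
  have right: "(data_size f s = 0) = w" if s: "s \<in> {t<..<t + \<delta>}" for s
  proof -
    have "(data_size f s = 0) = (v' = 0 \<and> d' = 0)"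
    proof (rule data_size_zero_iff_limit_zero[OF f F(2,4) trivial_limit_at_right_real _ _ s])
      show "\<forall>\<^sub>F r in at_right t. r \<in> {t<..<t + \<delta>}" using \<delta>(1) by (intro eventually_at_right_real) simp
      show "data_size f r \<le> 2 * data_size f s" if "r \<in> {t<..<t + \<delta>}" "s \<in> {t<..<t + \<delta>}" for r s
        using that \<delta>(1) by (intro comparable) auto
    qed
    also have "\<dots> = w" using F(5) ud by (auto simp: w_def)
    finally show ?thesis .
  qed
  have "\<forall>\<^sub>F s in at t. (data_size f s = 0) = w"
    unfolding eventually_at
  proof (intro exI[of _ \<delta>] conjI ballI impI \<delta>(1))
    fix s assume "s \<noteq> t \<and> dist s t < \<delta>"
    then show "(data_size f s = 0) = w" using left[of s] right[of s] by (cases "s < t") (auto simp: dist_real_def)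
  qed
  moreover have "(data_size f t = 0) = w" if "t \<notin> M"
    using F(6) that ud by (auto simp: data_size_def w_def add_nonneg_eq_0_iff)
  ultimately show ?thesis by blast
qed

lemma solution_zero_of_zero_data:
  assumes f: "impulse_solution S M \<alpha> V z f" and t: "t \<in> S"
    and "(f \<longlongrightarrow> 0) (at_left t)" "(D1 f \<longlongrightarrow> 0) (at_left t)" and s: "s \<in> S - M"
  shows "f s = 0"
proof -
  have loc: "\<exists>w. (\<forall>\<^sub>F s in at t. (data_size f s = 0) = w) \<and> (t \<notin> M \<longrightarrow> (data_size f t = 0) = w)"
    if t: "t \<in> S" for t
  proof -
    obtain u d where "(f \<longlongrightarrow> u) (at_left t)" "(D1 f \<longlongrightarrow> d) (at_left t)"
      using one_sided_limits[OF f t] by blast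
    from data_size_zero_locally_constant[OF f t this] show ?thesis by blast
  qed
  have near: "\<forall>\<^sub>F r in at t. data_size f r = 0"
    using data_size_zero_locally_constant[OF f t assms(3,4)] by simp
  moreover have "\<forall>\<^sub>F r in at t. r \<in> S - M"
  proof -
    have "\<forall>\<^sub>F r in at t. r \<notin> M" using no_limpt[OF t] by (simp add: islimpt_iff_eventually)
    moreover have "\<forall>\<^sub>F r in at t. r \<in> S" using open_S t by (rule eventually_at_in_open')
    ultimately show ?thesis by eventually_elim simp
  qed
  ultimately have "\<forall>\<^sub>F r in at t. data_size f r = 0 \<and> r \<in> S - M" by eventually_elim simp
  then obtain r where r: "data_size f r = 0" "r \<in> S - M"
    using eventually_happens[of _ "at t"] by auto
  have "(data_size f s = 0) = (data_size f r = 0)"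
    by (rule locally_constant_off_set[OF open_S connected_S loc s r(2)])
  with r show ?thesis by (simp add: data_size_def add_nonneg_eq_0_iff)
qed

text \<open>
  The boundary condition confines the pair of limits \<open>(f, f')\<close> to a fixed line in the plane, and
  \<open>W\<close> is the determinant of two such pairs.
\<close>
lemma wronskian_zero_of_boundary_condition:
  assumes f: "impulse_solution S M \<alpha> V z f" and g: "impulse_solution S M \<alpha> V z g"
    and F: "F \<noteq> bot" "\<forall>\<^sub>F r in F. r \<in> S - M"
    and bc: "boundary_condition F \<phi> f" "boundary_condition F \<phi> g" and s: "s \<in> S - M"
  shows "wronskian f g s = 0"
proof -
  obtain u d where fl: "(f \<longlongrightarrow> u) F" "(D1 f \<longlongrightarrow> d) F"
    and fe: "u * complex_of_real (cos \<phi>) + d * complex_of_real (sin \<phi>) = 0"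
    using bc(1) unfolding boundary_condition_def by blast
  obtain u' d' where gl: "(g \<longlongrightarrow> u') F" "(D1 g \<longlongrightarrow> d') F"
    and ge: "u' * complex_of_real (cos \<phi>) + d' * complex_of_real (sin \<phi>) = 0"
    using bc(2) unfolding boundary_condition_def by blast
  have "(wronskian f g \<longlongrightarrow> u * d' - d * u') F"
    unfolding wronskian_def[abs_def] by (intro tendsto_intros fl gl)
  moreover have "(wronskian f g \<longlongrightarrow> wronskian f g s) F"
    by (rule tendsto_eventually, use F(2) in eventually_elim) (rule wronskian_constant[OF f g _ s])
  ultimately have "wronskian f g s = u * d' - d * u'" using tendsto_unique[OF F(1)] by blast
  also have "\<dots> = 0"
  proof -
    define c where "c = complex_of_real (cos \<phi>)"
    define k where "k = complex_of_real (sin \<phi>)"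
    have "c * c + k * k = 1"
      unfolding c_def k_def by (metis of_real_add of_real_mult of_real_1 sin_cos_squared_add3)
    then have "u * d' - d * u' = (c * c + k * k) * (u * d' - d * u')" by simp
    \<comment> \<open>The determinant as a combination of the two boundary expressions.\<close>
    also have "\<dots> = (u * c + d * k) * (c * d' - k * u') - (u' * c + d' * k) * (c * d - k * u)"
      by (simp add: algebra_simps)
    also have "\<dots> = 0" using fe ge by (simp add: c_def k_def)
    finally show ?thesis .
  qed
  finally show ?thesis .
qed

text \<open>
  The three-term identity \<open>h W(f,g) = f W(h,g) - g W(h,f)\<close> is the expansion of a determinant with
  two equal rows. Its Wronskians are constants, so if \<open>W(f,g) \<noteq> 0\<close>, it writes the solution \<open>h\<close> as
  a linear combination of the square integrable \<open>f\<close> and \<open>g\<close>.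
\<close>
lemma wronskian_zero_of_limit_point:
  assumes f: "impulse_solution S M \<alpha> V z f" and g: "impulse_solution S M \<alpha> V z g"
    and h: "impulse_solution S M \<alpha> V z h" and M: "countable M"
    and sq: "square_integrable_on S f" "square_integrable_on S g" "\<not> square_integrable_on S h"
    and s: "s \<in> S - M"
  shows "wronskian f g s = 0"
proof (rule ccontr)
  assume w: "wronskian f g s \<noteq> 0"
  define p where "p = wronskian h g s / wronskian f g s"
  define q where "q = - wronskian h f s / wronskian f g s"
  have comb: "p * f t + q * g t = h t" if t: "t \<in> S - M" for t
  proof -
    have "h t * wronskian f g t = f t * wronskian h g t - g t * wronskian h f t"
      by (simp add: wronskian_def algebra_simps)
    then have "h t * wronskian f g s = f t * wronskian h g s - g t * wronskian h f s"
      using wronskian_constant[OF f g t s] wronskian_constant[OF h g t s] wronskian_constant[OF h f t s] by simp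
    with w show ?thesis by (simp add: p_def q_def field_simps)
  qed
  let ?L = "lebesgue_on S"
  have pt: "{t} \<in> sets ?L" "emeasure ?L {t} = 0" if "t \<in> S" for t
    using that open_S by (auto simp: sets_restrict_space_iff emeasure_restrict_space)
  have [measurable]: "f \<in> borel_measurable ?L" "g \<in> borel_measurable ?L"
    and int: "integrable ?L (\<lambda>t. (cmod (f t))\<^sup>2)" "integrable ?L (\<lambda>t. (cmod (g t))\<^sup>2)"
    using sq(1,2) by (auto simp: square_integrable_on_def)
  have "h \<in> borel_measurable ?L"
  proof (rule measurable_discrete_difference[where X = "S \<inter> M"])
    show "(\<lambda>t. p * f t + q * g t) \<in> borel_measurable ?L" by measurable
    show "countable (S \<inter> M)" using M by (rule countable_subset[rotated]) auto
  qed (use pt comb in auto)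
  moreover have "integrable ?L (\<lambda>t. (cmod (h t))\<^sup>2)"
  proof (subst integrable_discrete_difference[where X = "S \<inter> M", symmetric])
    show "integrable ?L (\<lambda>t. (cmod (p * f t + q * g t))\<^sup>2)"
    proof (rule Bochner_Integration.integrable_bound)
      show "integrable ?L (\<lambda>t. 2 * (cmod p)\<^sup>2 * (cmod (f t))\<^sup>2 + 2 * (cmod q)\<^sup>2 * (cmod (g t))\<^sup>2)"
        using int by (intro Bochner_Integration.integrable_add integrable_mult_right)
      show "AE t in ?L. norm ((cmod (p * f t + q * g t))\<^sup>2)
          \<le> norm (2 * (cmod p)\<^sup>2 * (cmod (f t))\<^sup>2 + 2 * (cmod q)\<^sup>2 * (cmod (g t))\<^sup>2)"
      proof (rule AE_I2)
        fix t
        have "(cmod (p * f t + q * g t))\<^sup>2 \<le> (cmod (p * f t) + cmod (q * g t))\<^sup>2"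
          by (intro power_mono norm_triangle_ineq) auto
        also have "\<dots> \<le> 2 * (cmod (p * f t))\<^sup>2 + 2 * (cmod (q * g t))\<^sup>2"
          using sum_squares_bound[of "cmod (p * f t)" "cmod (q * g t)"] by (simp add: power2_sum)
        finally show "norm ((cmod (p * f t + q * g t))\<^sup>2)
          \<le> norm (2 * (cmod p)\<^sup>2 * (cmod (f t))\<^sup>2 + 2 * (cmod q)\<^sup>2 * (cmod (g t))\<^sup>2)"
          by (simp add: norm_mult power_mult_distrib mult.assoc)
      qed
    qed measurable
    show "countable (S \<inter> M)" using M by (rule countable_subset[rotated]) auto
  qed (use pt comb in auto)
  ultimately show False using sq(3) by (simp add: square_integrable_on_def)
qed

end

section \<open>Eigenfunctions near the endpoints\<close>

lemma impulse_interval_einterval: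
  assumes "\<And>y. y \<in> einterval a b \<Longrightarrow> \<not> y islimpt M" "locally_integrable_on (einterval a b) V"
    and "einterval c d \<subseteq> einterval a b"
  shows "impulse_interval (einterval c d) M V"
proof
  show "connected (einterval c d)"
  proof (rule is_interval_connected, unfold is_interval_1, intro ballI allI impI)
    fix r s t assume "r \<in> einterval c d" "s \<in> einterval c d" "r \<le> t \<and> t \<le> s"
    then show "t \<in> einterval c d"
      unfolding einterval_iff by (meson ereal_less_eq(3) le_less_trans less_le_trans)
  qed
  show "locally_integrable_on (einterval c d) V"
    using assms(2,3) unfolding locally_integrable_on_def by (meson subset_trans)
qed (use assms in auto)

lemma tau_eq_subset:
  assumes "tau_eq T V f g" "S \<subseteq> T" "open S" "open T"
  shows "tau_eq S V f g"
proof -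
  have "S \<inter> space lebesgue \<in> sets lebesgue" "T \<inter> space lebesgue \<in> sets lebesgue" using assms by auto
  note iffs = this[THEN AE_restrict_space_iff]
  from assms(1) have "AE t in lebesgue. t \<in> T \<longrightarrow> (\<exists>f2. (D1 f has_vector_derivative f2) (at t) \<and>
        g t = - f2 + complex_of_real (V t) * f t)"
    unfolding tau_eq_def iffs(2) .
  then have "AE t in lebesgue. t \<in> S \<longrightarrow> (\<exists>f2. (D1 f has_vector_derivative f2) (at t) \<and>
        g t = - f2 + complex_of_real (V t) * f t)"
    by eventually_elim (use assms(2) in blast)
  then show ?thesis unfolding tau_eq_def iffs(1) .
qed

lemma solution_imp_impulse_solution:
  assumes f: "solution a b V I x w z f" and sub: "S \<subseteq> einterval a b" "open S"
    and \<alpha>: "\<And>n. n \<in> I \<Longrightarrow> x n \<in> S \<Longrightarrow> \<alpha> (x n) = w n"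
  shows "impulse_solution S (x ` I) \<alpha> V z f"
  unfolding impulse_solution_def
proof (intro conjI ballI)
  have "S - x ` I \<subseteq> einterval a b - x ` I" using sub by blast
  then show "AC2_on (S - x ` I) f"
    using f unfolding solution_def AC2_on_def locally_abs_cont_on_def by (meson subsetD subset_trans)
  show "tau_eq S V f (\<lambda>t. z * f t)"
    using f tau_eq_subset[OF _ sub open_einterval] unfolding solution_def by blast
  fix t assume "t \<in> S \<inter> x ` I"
  then obtain n where "n \<in> I" "t = x n" "x n \<in> S" by blast
  with f \<alpha> show "delta'_condition (\<alpha> t) t f" unfolding solution_def by auto
qed

lemma square_integrable_on_subset:
  assumes f: "square_integrable_on T f" and "S \<subseteq> T" "open S" "open T"
  shows "square_integrable_on S f"
proof -
  have "integrable (lebesgue_on T) (\<lambda>t. (cmod (f t))\<^sup>2)" "f \<in> borel_measurable (lebesgue_on T)"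
    using f by (auto simp: square_integrable_on_def)
  then have "set_integrable lebesgue T (\<lambda>t. (cmod (f t))\<^sup>2)" "f \<in> borel_measurable (lebesgue_on S)"
    using assms by (auto simp: set_integrable_def integrable_restrict_space intro: measurable_restrict_mono)
  moreover from this have "set_integrable lebesgue S (\<lambda>t. (cmod (f t))\<^sup>2)"
    using assms by (auto intro: set_integrable_subset)
  ultimately show ?thesis
    using assms by (simp add: square_integrable_on_def set_integrable_def integrable_restrict_space)
qed

lemma AE_lebesgue_on_off_countable:
  assumes "countable M" "open S" "\<And>t. t \<in> S - M \<Longrightarrow> P t"
  shows "AE t in lebesgue_on S. P t"
proof -
  have S: "S \<inter> space lebesgue \<in> sets lebesgue" using assms(2) by simp
  have "M \<in> null_sets lebesgue"
    using assms(1) countable_imp_null_set_lborel null_sets_completionI by blast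
  then have "AE t in lebesgue. t \<notin> M" by (rule AE_not_in)
  then have "AE t in lebesgue. t \<in> S \<longrightarrow> P t" by eventually_elim (use assms(3) in blast)
  then show ?thesis unfolding AE_restrict_space_iff[OF S] .
qed

text \<open>
  The point \<open>c\<close> will be the centre whose coupling is changed: to the left of it \<open>f\<close> and \<open>g\<close> solve
  the same problem, although they belong to different coupling sequences.
\<close>
lemma wronskian_zero_left:
  assumes discrete: "\<And>y. y \<in> einterval a b \<Longrightarrow> \<not> y islimpt x ` I"
    and V: "locally_integrable_on (einterval a b) V"
    and c: "c \<in> einterval a b" and "einterval a (ereal c) \<subseteq> einterval a b"
    and f: "impulse_solution (einterval a (ereal c)) (x ` I) \<alpha> V z f" "square_integrable_on (einterval a b) f"
      "regular_left a b V I x \<Longrightarrow> boundary_condition (at_right (real_of_ereal a)) \<phi> f"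
    and g: "impulse_solution (einterval a (ereal c)) (x ` I) \<alpha> V z g" "square_integrable_on (einterval a b) g"
      "regular_left a b V I x \<Longrightarrow> boundary_condition (at_right (real_of_ereal a)) \<phi> g"
    and left_end: "regular_left a b V I x \<or> lpc_left a b V I x w"
    and \<alpha>: "\<And>n. n \<in> I \<Longrightarrow> x n \<noteq> c \<Longrightarrow> \<alpha> (x n) = w n"
    and s: "s \<in> einterval a (ereal c) - x ` I"
  shows "wronskian f g s = 0"
proof -
  let ?S = "einterval a (ereal c)"
  have sub: "?S \<subseteq> einterval a b" by fact
  interpret L: impulse_interval ?S "x ` I" V by (rule impulse_interval_einterval[OF discrete V sub])
  show ?thesis
  proof (cases "regular_left a b V I x")
    case True
    define a' where "a' = real_of_ereal a"
    have a: "a = ereal a'" and limpt: "\<not> a' islimpt x ` I"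
      using True by (auto simp: regular_left_def a'_def ereal_real)
    have "\<forall>\<^sub>F r in at_right a'. r \<notin> x ` I"
      using limpt unfolding islimpt_iff_eventually by (simp add: eventually_at_split)
    moreover have "\<forall>\<^sub>F r in at_right a'. r \<in> {a'<..<c}"
      using c a by (intro eventually_at_right_real) (simp add: einterval_iff)
    ultimately have ev: "\<forall>\<^sub>F r in at_right a'. r \<in> ?S - x ` I"
      by eventually_elim (simp add: einterval_iff a)
    show ?thesis
      by (rule L.wronskian_zero_of_boundary_condition[OF f(1) g(1) trivial_limit_at_right_real ev _ _ s])
        (use f(3) g(3) True in \<open>auto simp: a'_def\<close>)
  next
    case False
    then obtain h where h: "solution a b V I x w z h" "\<not> square_integrable_on ?S h"
      using left_end c unfolding lpc_left_def by blast
    have "impulse_solution ?S (x ` I) \<alpha> V z h"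
      using \<alpha> by (intro solution_imp_impulse_solution[OF h(1) sub]) (auto simp: einterval_iff)
    then show ?thesis
      using f g h s square_integrable_on_subset[OF _ sub]
      by (intro L.wronskian_zero_of_limit_point[OF f(1) g(1), of h]) auto
  qed
qed

lemma wronskian_zero_right:
  assumes discrete: "\<And>y. y \<in> einterval a b \<Longrightarrow> \<not> y islimpt x ` I"
    and V: "locally_integrable_on (einterval a b) V"
    and c: "c \<in> einterval a b" and "einterval (ereal c) b \<subseteq> einterval a b"
    and f: "impulse_solution (einterval (ereal c) b) (x ` I) \<alpha> V z f" "square_integrable_on (einterval a b) f"
      "regular_right a b V I x \<Longrightarrow> boundary_condition (at_left (real_of_ereal b)) \<phi> f"
    and g: "impulse_solution (einterval (ereal c) b) (x ` I) \<alpha> V z g" "square_integrable_on (einterval a b) g"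
      "regular_right a b V I x \<Longrightarrow> boundary_condition (at_left (real_of_ereal b)) \<phi> g"
    and right_end: "regular_right a b V I x \<or> lpc_right a b V I x w"
    and \<alpha>: "\<And>n. n \<in> I \<Longrightarrow> x n \<noteq> c \<Longrightarrow> \<alpha> (x n) = w n"
    and s: "s \<in> einterval (ereal c) b - x ` I"
  shows "wronskian f g s = 0"
proof -
  let ?S = "einterval (ereal c) b"
  have sub: "?S \<subseteq> einterval a b" by fact
  interpret R: impulse_interval ?S "x ` I" V by (rule impulse_interval_einterval[OF discrete V sub])
  show ?thesis
  proof (cases "regular_right a b V I x")
    case True
    define b' where "b' = real_of_ereal b"
    have b: "b = ereal b'" and limpt: "\<not> b' islimpt x ` I"
      using True by (auto simp: regular_right_def b'_def ereal_real)
    have "\<forall>\<^sub>F r in at_left b'. r \<notin> x ` I"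
      using limpt unfolding islimpt_iff_eventually by (simp add: eventually_at_split)
    moreover have "\<forall>\<^sub>F r in at_left b'. r \<in> {c<..<b'}"
      using c b by (intro eventually_at_left_real) (simp add: einterval_iff)
    ultimately have ev: "\<forall>\<^sub>F r in at_left b'. r \<in> ?S - x ` I"
      by eventually_elim (simp add: einterval_iff b)
    show ?thesis
      by (rule R.wronskian_zero_of_boundary_condition[OF f(1) g(1) trivial_limit_at_left_real ev _ _ s])
        (use f(3) g(3) True in \<open>auto simp: b'_def\<close>)
  next
    case False
    then obtain h where h: "solution a b V I x w z h" "\<not> square_integrable_on ?S h"
      using right_end c unfolding lpc_right_def by blast
    have "impulse_solution ?S (x ` I) \<alpha> V z h"
      using \<alpha> by (intro solution_imp_impulse_solution[OF h(1) sub]) (auto simp: einterval_iff)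
    then show ?thesis
      using f g h s square_integrable_on_subset[OF _ sub]
      by (intro R.wronskian_zero_of_limit_point[OF f(1) g(1), of h]) auto
  qed
qed

section \<open>Moving one coordinate in a product of continuous measures\<close>

text \<open>
  By Fubini's theorem the points of \<open>B\<close> lying on null fibres form a null set: on each line in
  direction \<open>n\<close>, either the fibre of \<open>B\<close> has positive measure, or almost no point of the line is in
  \<open>B\<close>.
\<close>
lemma AE_fibre_not_null:
  fixes p :: "'i \<Rightarrow> 'a measure"
  assumes prob: "\<And>i. i \<in> I \<Longrightarrow> prob_space (p i)" and n: "n \<in> I"
    and B [measurable]: "B \<in> sets (PiM I p)"
  shows "AE w in PiM I p. w \<in> B \<longrightarrow> emeasure (p n) {r \<in> space (p n). w(n := r) \<in> B} \<noteq> 0"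
proof -
  interpret N: prob_space "p n" by (rule prob[OF n])
  interpret R: prob_space "PiM (I - {n}) p" using prob by (intro prob_space_PiM) auto
  interpret NR: pair_prob_space "p n" "PiM (I - {n}) p" ..
  have ins: "insert n (I - {n}) = I" using n by auto
  define Q where "Q w \<longleftrightarrow> (w \<in> B \<longrightarrow> emeasure (p n) {r \<in> space (p n). w(n := r) \<in> B} \<noteq> 0)" for w
  have upd [measurable]: "(\<lambda>(w, r). w(n := r)) \<in> PiM I p \<Otimes>\<^sub>M p n \<rightarrow>\<^sub>M PiM I p"
    using n measurable_add_dim[of n I p] by (simp add: insert_absorb)
  have upd' [measurable]: "(\<lambda>(r, w). w(n := r)) \<in> p n \<Otimes>\<^sub>M PiM (I - {n}) p \<rightarrow>\<^sub>M PiM I p"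
    using measurable_comp[OF measurable_pair_swap' measurable_add_dim[of n "I - {n}" p]]
    by (simp only: ins comp_def split_def prod.sel fst_swap snd_swap fst_conv snd_conv)
  have [measurable]: "(\<lambda>w. emeasure (p n) {r \<in> space (p n). w(n := r) \<in> B}) \<in> borel_measurable (PiM I p)"
  proof (rule N.measurable_emeasure)
    have "{z \<in> space (PiM I p \<Otimes>\<^sub>M p n). (case z of (w, r) \<Rightarrow> w(n := r)) \<in> B} \<in> sets (PiM I p \<Otimes>\<^sub>M p n)"
      by measurable
    then show "{z \<in> space (PiM I p \<Otimes>\<^sub>M p n). snd z \<in> {r \<in> space (p n). (fst z)(n := r) \<in> B}}
        \<in> sets (PiM I p \<Otimes>\<^sub>M p n)"
      by (rule back_subst[of "\<lambda>X. X \<in> sets (PiM I p \<Otimes>\<^sub>M p n)"]) (auto simp: space_pair_measure split_def)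
  qed auto
  have Q_meas: "{w \<in> space (PiM I p). Q w} \<in> sets (PiM I p)" unfolding Q_def by measurable
  have "AE z in p n \<Otimes>\<^sub>M PiM (I - {n}) p. Q (case z of (r, w) \<Rightarrow> w(n := r))"
  proof -
    have meas: "{z \<in> space (p n \<Otimes>\<^sub>M PiM (I - {n}) p). Q ((snd z)(n := fst z))}
        \<in> sets (p n \<Otimes>\<^sub>M PiM (I - {n}) p)"
      using measurable_sets[OF upd' Q_meas]
      by (rule back_subst[of "\<lambda>X. X \<in> sets (p n \<Otimes>\<^sub>M PiM (I - {n}) p)"])
         (use measurable_space[OF upd'] in \<open>auto simp: split_def\<close>)
    have "AE r in p n. Q (w(n := r))" if w: "w \<in> space (PiM (I - {n}) p)" for w
    proof (cases "emeasure (p n) {r \<in> space (p n). w(n := r) \<in> B} = 0")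
      case True
      have "{r \<in> space (p n). w(n := r) \<in> B} \<in> sets (p n)"
      proof -
        have "(\<lambda>r. w(n := r)) \<in> p n \<rightarrow>\<^sub>M PiM I p"
          using measurable_compose[OF measurable_Pair2'[OF w] upd'] by simp
        from measurable_sets[OF this B] show ?thesis by (simp add: vimage_def Int_def conj_commute)
      qed
      with True have "AE r in p n. r \<notin> {r \<in> space (p n). w(n := r) \<in> B}"
        by (intro AE_not_in) (auto simp: null_sets_def)
      then show ?thesis using AE_space by eventually_elim (auto simp: Q_def)
    next
      case False
      then show ?thesis by (auto simp: Q_def)
    qed
    then have "AE w in PiM (I - {n}) p. AE r in p n. Q (w(n := r))" by (rule AE_I2)
    then have "AE r in p n. AE w in PiM (I - {n}) p. Q (w(n := r))"
      by (subst NR.AE_commute[OF meas])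
    then show ?thesis by (subst (asm) NR.AE_pair_iff[OF meas]) (simp add: split_def)
  qed
  moreover have "distr (p n \<Otimes>\<^sub>M PiM (I - {n}) p) (PiM I p) (\<lambda>(r, w). w(n := r)) = PiM I p"
    using distr_pair_PiM_eq_PiM[of "I - {n}" p n] prob n by (simp add: insert_absorb)
  ultimately have "AE w in PiM I p. Q w"
    using AE_distr_iff[OF upd' Q_meas] by metis
  then show ?thesis unfolding Q_def .
qed

text \<open>
  Membership in a set of the completion is only almost measurable, so Fubini's theorem is applied to the
  measurable core of \<open>B\<close>.
\<close>
lemma exists_point_with_movable_coordinates:
  fixes p :: "'i \<Rightarrow> 'a measure"
  assumes prob: "\<And>i. i \<in> I \<Longrightarrow> prob_space (p i)" and "countable I"
    and cont: "\<And>i r. i \<in> I \<Longrightarrow> emeasure (p i) {r} = 0"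
    and sing: "\<And>i r. i \<in> I \<Longrightarrow> {r} \<in> sets (p i)"
    and B: "B \<in> sets (completion (PiM I p))" and pos: "emeasure (completion (PiM I p)) B \<noteq> 0"
  shows "\<exists>w\<in>B. \<forall>i\<in>I. \<exists>r. r \<noteq> w i \<and> w(i := r) \<in> B"
proof -
  define C where "C = main_part (PiM I p) B"
  have C: "C \<in> sets (PiM I p)" "C \<subseteq> B" "emeasure (PiM I p) C \<noteq> 0"
    using main_part_sets[OF B] main_part_null_part_Un[OF B] pos
    by (simp_all only: C_def emeasure_completion[OF B, symmetric]) blast+
  have "AE w in PiM I p. \<forall>i\<in>I. w \<in> C \<longrightarrow> emeasure (p i) {r \<in> space (p i). w(i := r) \<in> C} \<noteq> 0"
    using AE_fibre_not_null[OF prob _ C(1)] by (subst AE_ball_countable[OF \<open>countable I\<close>]) blast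
  moreover have "\<not> (AE w in PiM I p. w \<notin> C)"
    using C(3) AE_iff_null_sets[OF C(1)] by (simp add: null_sets_def)
  moreover have "AE w in PiM I p. w \<notin> C"
    if "\<not> (\<exists>w\<in>C. \<forall>i\<in>I. emeasure (p i) {r \<in> space (p i). w(i := r) \<in> C} \<noteq> 0)"
      and "AE w in PiM I p. \<forall>i\<in>I. w \<in> C \<longrightarrow> emeasure (p i) {r \<in> space (p i). w(i := r) \<in> C} \<noteq> 0"
    using that(2) by eventually_elim (use that(1) in blast)
  ultimately have "\<exists>w\<in>C. \<forall>i\<in>I. emeasure (p i) {r \<in> space (p i). w(i := r) \<in> C} \<noteq> 0"
    by blast
  then obtain w where w: "w \<in> C"
      "\<And>i. i \<in> I \<Longrightarrow> emeasure (p i) {r \<in> space (p i). w(i := r) \<in> C} \<noteq> 0"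
    by blast
  have "\<exists>r. r \<noteq> w i \<and> w(i := r) \<in> B" if i: "i \<in> I" for i
  proof (rule ccontr)
    assume "\<not> ?thesis"
    then have "{r \<in> space (p i). w(i := r) \<in> C} \<subseteq> {w i}" using C by auto
    then have "emeasure (p i) {r \<in> space (p i). w(i := r) \<in> C} \<le> emeasure (p i) {w i}"
      by (intro emeasure_mono sing i)
    with w(2)[OF i] cont[OF i] show False by simp
  qed
  with w C show ?thesis by blast
qed

section \<open>Eigenvalues shared by many couplings\<close>

lemma eigenfunctionD:
  assumes "(f, \<lambda>t. z * f t) \<in> H_op a b V I x \<theta> \<gamma> w"
  shows "solution a b V I x w z f" "square_integrable_on (einterval a b) f"
    "regular_left a b V I x \<Longrightarrow> boundary_condition (at_right (real_of_ereal a)) \<theta> f"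
    "regular_right a b V I x \<Longrightarrow> boundary_condition (at_left (real_of_ereal b)) \<gamma> f"
  using assms unfolding H_op_def T_max_def solution_def by auto

text \<open>
  Both one-sided Wronskians at \<open>x n\<close> vanish, and their difference is
  \<open>(w n - r) f'(x n) g'(x n)\<close>. The factor \<open>g'(x n)\<close> cannot be the one that vanishes: together with
  \<open>W = 0\<close> and \<open>f'(x n) \<noteq> 0\<close> it would give \<open>g\<close> zero data at \<open>x n\<close>.
\<close>
lemma eigenfunction_derivative_zero_at_moved_centre:
  assumes V: "locally_integrable_on (einterval a b) V"
    and centres: "inj_on x I" "x ` I \<subseteq> einterval a b"
    and discrete: "\<And>y. y \<in> einterval a b \<Longrightarrow> \<not> y islimpt x ` I"
    and left_end: "regular_left a b V I x \<or> lpc_left a b V I x w"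
    and right_end: "regular_right a b V I x \<or> lpc_right a b V I x w"
    and n: "n \<in> I" and r: "r \<noteq> w n"
    and f: "(f, \<lambda>t. z * f t) \<in> H_op a b V I x \<theta> \<gamma> w"
    and g: "(g, \<lambda>t. z * g t) \<in> H_op a b V I x \<theta> \<gamma> (w(n := r))"
    and g_nonzero: "\<not> (AE t in lebesgue_on (einterval a b). g t = 0)"
    and d: "(D1 f \<longlongrightarrow> d) (at_left (x n))"
  shows "d = 0"
proof (rule ccontr)
  assume "d \<noteq> 0"
  let ?J = "einterval a b" and ?L = "einterval a (ereal (x n))" and ?R = "einterval (ereal (x n)) b"
  note F = eigenfunctionD[OF f] and G = eigenfunctionD[OF g]
  have xn: "x n \<in> ?J" using n centres(2) by auto
  have sub: "?L \<subseteq> ?J" "?R \<subseteq> ?J"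
    using xn unfolding einterval_def by (auto intro: less_trans[of _ "ereal (x n)"])
  define \<alpha> where "\<alpha> = w \<circ> inv_into I x"
  define \<beta> where "\<beta> = w(n := r) \<circ> inv_into I x"
  have \<alpha>: "\<alpha> (x m) = w m" if "m \<in> I" for m using that centres(1) by (simp add: \<alpha>_def)
  have \<alpha>': "\<alpha> (x m) = (w(n := r)) m" if "m \<in> I" "x m \<noteq> x n" for m using \<alpha> that by auto
  have \<beta>: "\<beta> (x m) = (w(n := r)) m" if "m \<in> I" for m using that centres(1) by (simp add: \<beta>_def)
  interpret J: impulse_interval ?J "x ` I" V by (rule impulse_interval_einterval[OF discrete V order_refl])
  have fJ: "impulse_solution ?J (x ` I) \<alpha> V z f"
    using \<alpha> by (intro solution_imp_impulse_solution[OF F(1)]) auto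
  have gJ: "impulse_solution ?J (x ` I) \<beta> V z g"
    using \<beta> by (intro solution_imp_impulse_solution[OF G(1)]) auto
  obtain u v d1 where fl: "(f \<longlongrightarrow> u) (at_left (x n))" "(f \<longlongrightarrow> v) (at_right (x n))"
    "(D1 f \<longlongrightarrow> d1) (at_left (x n))" "(D1 f \<longlongrightarrow> d1) (at_right (x n))" "v - u = complex_of_real (w n) * d1"
    using J.one_sided_limits[OF fJ xn] n \<alpha>[OF n] by auto
  have "d1 = d" using tendsto_unique[OF trivial_limit_at_left_real fl(3) d] .
  obtain u' v' d' where gl: "(g \<longlongrightarrow> u') (at_left (x n))" "(g \<longlongrightarrow> v') (at_right (x n))"
    "(D1 g \<longlongrightarrow> d') (at_left (x n))" "(D1 g \<longlongrightarrow> d') (at_right (x n))" "v' - u' = complex_of_real r * d'"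
    using J.one_sided_limits[OF gJ xn] n \<beta>[OF n] by auto
  have off: "\<forall>\<^sub>F t in at (x n). t \<notin> x ` I"
    using discrete[OF xn] unfolding islimpt_iff_eventually by simp
  have left: "u * d' - d * u' = 0"
  proof -
    have fL: "impulse_solution ?L (x ` I) \<alpha> V z f"
      using \<alpha> sub by (intro solution_imp_impulse_solution[OF F(1)]) auto
    have gL: "impulse_solution ?L (x ` I) \<alpha> V z g"
      using \<alpha>' sub by (intro solution_imp_impulse_solution[OF G(1)]) (auto simp: einterval_iff)
    have zero: "wronskian f g s = 0" if "s \<in> ?L - x ` I" for s
      by (rule wronskian_zero_left[OF discrete V xn sub(1) fL F(2,3) gL G(2,3) left_end \<alpha> that])
    have "\<forall>\<^sub>F t in at_left (x n). t \<in> ?J"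
      using eventually_at_in_open'[OF open_einterval xn] by (simp add: eventually_at_split)
    moreover have "\<forall>\<^sub>F t in at_left (x n). t < x n" by (simp add: eventually_at_filter)
    moreover have "\<forall>\<^sub>F t in at_left (x n). t \<notin> x ` I" using off by (simp add: eventually_at_split)
    ultimately have "\<forall>\<^sub>F t in at_left (x n). wronskian f g t = 0"
      by eventually_elim (auto intro!: zero simp: einterval_iff)
    then have "(wronskian f g \<longlongrightarrow> 0) (at_left (x n))" by (rule tendsto_eventually)
    moreover have "(wronskian f g \<longlongrightarrow> u * d' - d * u') (at_left (x n))"
      unfolding wronskian_def[abs_def] by (intro tendsto_intros fl gl d)
    ultimately show ?thesis by (metis tendsto_unique trivial_limit_at_left_real)
  qed
  have right: "v * d' - d * v' = 0"
  proof -
    have fR: "impulse_solution ?R (x ` I) \<alpha> V z f"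
      using \<alpha> sub by (intro solution_imp_impulse_solution[OF F(1)]) auto
    have gR: "impulse_solution ?R (x ` I) \<alpha> V z g"
      using \<alpha>' sub by (intro solution_imp_impulse_solution[OF G(1)]) (auto simp: einterval_iff)
    have zero: "wronskian f g s = 0" if "s \<in> ?R - x ` I" for s
      by (rule wronskian_zero_right[OF discrete V xn sub(2) fR F(2,4) gR G(2,4) right_end \<alpha> that])
    have "\<forall>\<^sub>F t in at_right (x n). t \<in> ?J"
      using eventually_at_in_open'[OF open_einterval xn] by (simp add: eventually_at_split)
    moreover have "\<forall>\<^sub>F t in at_right (x n). x n < t" by (simp add: eventually_at_filter)
    moreover have "\<forall>\<^sub>F t in at_right (x n). t \<notin> x ` I" using off by (simp add: eventually_at_split)
    ultimately have "\<forall>\<^sub>F t in at_right (x n). wronskian f g t = 0"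
      by eventually_elim (auto intro!: zero simp: einterval_iff)
    then have "(wronskian f g \<longlongrightarrow> 0) (at_right (x n))" by (rule tendsto_eventually)
    moreover have "(wronskian f g \<longlongrightarrow> v * d' - d * v') (at_right (x n))"
      unfolding wronskian_def[abs_def] using fl(4) \<open>d1 = d\<close> by (intro tendsto_intros fl gl) simp
    ultimately show ?thesis by (metis tendsto_unique trivial_limit_at_right_real)
  qed
  have "(complex_of_real (w n) - complex_of_real r) * d * d' = (v - u) * d' - d * (v' - u')"
    using fl(5) gl(5) \<open>d1 = d\<close> by (simp add: algebra_simps)
  also have "\<dots> = (v * d' - d * v') - (u * d' - d * u')" by (simp add: algebra_simps)
  also have "\<dots> = 0" using left right by simp
  finally have "d' = 0" using r \<open>d \<noteq> 0\<close> by auto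
  with left \<open>d \<noteq> 0\<close> have "u' = 0" by simp
  have "g t = 0" if "t \<in> ?J - x ` I" for t
    using J.solution_zero_of_zero_data[OF gJ xn _ _ that] gl(1,3) \<open>u' = 0\<close> \<open>d' = 0\<close> by simp
  moreover have "countable (x ` I)" by simp
  ultimately have "AE t in lebesgue_on ?J. g t = 0" by (intro AE_lebesgue_on_off_countable[where M = "x ` I"]) auto
  with g_nonzero show False by simp
qed

text \<open>
  With \<open>f'(y) = 0\<close> the jump \<open>\<alpha> f'(y)\<close> is zero whatever \<open>\<alpha>\<close> is.
\<close>
lemma delta'_condition_of_derivative_zero:
  assumes "delta'_condition \<alpha> y f" "\<And>d. (D1 f \<longlongrightarrow> d) (at_left y) \<Longrightarrow> d = 0"
  shows "delta'_condition \<beta> y f"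
  using assms unfolding delta'_condition_def by fastforce

theorem theorem5p1:
  fixes I :: "int set" and p :: "int \<Rightarrow> real measure"
    and a b :: ereal and V :: "real \<Rightarrow> real" and x :: "int \<Rightarrow> real"
    and \<theta> \<gamma> E :: real and \<Omega> :: "(int \<Rightarrow> real) measure" and B :: "(int \<Rightarrow> real) set"
  assumes prob: "\<And>n. n \<in> I \<Longrightarrow> prob_space (p n)"
    and borel: "\<And>n. n \<in> I \<Longrightarrow> sets (p n) = sets borel"
    and continuous: "\<And>n r. n \<in> I \<Longrightarrow> emeasure (p n) {r} = 0"
    and Omega: "\<Omega> = completion (PiM I p)"
    and interval: "a < b"
    and potential: "locally_integrable_on (einterval a b) V"
    and centres: "inj_on x I" "x ` I \<subseteq> einterval a b"
    and discrete: "\<And>y. y \<in> einterval a b \<Longrightarrow> \<not> y islimpt x ` I"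
    and angles: "\<theta> \<in> {0..<pi}" "\<gamma> \<in> {0..<pi}"
    and left_end: "\<And>\<omega>. \<omega> \<in> space \<Omega> \<Longrightarrow> regular_left a b V I x \<or> lpc_left a b V I x \<omega>"
    and right_end: "\<And>\<omega>. \<omega> \<in> space \<Omega> \<Longrightarrow> regular_right a b V I x \<or> lpc_right a b V I x \<omega>"
    and B_measurable: "B \<in> sets \<Omega>"
    and B_subset: "B \<subseteq> eigenvalue_event a b V I x \<theta> \<gamma> \<Omega> E"
  shows "emeasure \<Omega> B = 0 \<or> eigenvalue_event a b V I x \<theta> \<gamma> \<Omega> E = space \<Omega>"
proof (cases "emeasure \<Omega> B = 0")
  case False
  let ?A = "eigenvalue_event a b V I x \<theta> \<gamma> \<Omega> E" and ?E = "complex_of_real E"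
  have "\<exists>w\<in>B. \<forall>n\<in>I. \<exists>r. r \<noteq> w n \<and> w(n := r) \<in> B"
  proof (rule exists_point_with_movable_coordinates[of I p])
    show "B \<in> sets (completion (PiM I p))" "emeasure (completion (PiM I p)) B \<noteq> 0"
      using False B_measurable unfolding Omega by blast+
  qed (auto simp: borel prob continuous)
  then obtain w where w: "w \<in> B" "\<And>n. n \<in> I \<Longrightarrow> \<exists>r. r \<noteq> w n \<and> w(n := r) \<in> B" by blast
  have "w \<in> space \<Omega>" using w(1) B_subset by (auto simp: eigenvalue_event_def)
  note ends = left_end[OF this] right_end[OF this]
  obtain f where f: "(f, \<lambda>t. ?E * f t) \<in> H_op a b V I x \<theta> \<gamma> w"
    and f_nonzero: "\<not> (AE t in lebesgue_on (einterval a b). f t = 0)"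
    using w(1) B_subset unfolding eigenvalue_event_def point_spectrum_def by blast
  have zero: "d = 0" if n: "n \<in> I" and d: "(D1 f \<longlongrightarrow> d) (at_left (x n))" for n d
  proof -
    obtain r where r: "r \<noteq> w n" "w(n := r) \<in> B" using w(2)[OF n] by blast
    then obtain g where g: "(g, \<lambda>t. ?E * g t) \<in> H_op a b V I x \<theta> \<gamma> (w(n := r))"
      and g_nonzero: "\<not> (AE t in lebesgue_on (einterval a b). g t = 0)"
      using B_subset unfolding eigenvalue_event_def point_spectrum_def by blast
    show ?thesis
      by (rule eigenfunction_derivative_zero_at_moved_centre[OF potential centres discrete ends n r(1) f g g_nonzero d])
  qed
  have "(f, \<lambda>t. ?E * f t) \<in> H_op a b V I x \<theta> \<gamma> w'" for w'
    using f zero delta'_condition_of_derivative_zero unfolding H_op_def T_max_def by blast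
  with f_nonzero have "?A = space \<Omega>" unfolding eigenvalue_event_def point_spectrum_def by blast
  then show ?thesis ..
qed simp

end
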